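(* For each $p\in\mathring L_r^2(T^{\rm ps})$ (resp., $p\in L_r^2(T^{\rm ps})$) there exists $v\in\mathring S_{r+1}^1(T^{\rm ps})$ (resp., $v\in S_{r+1}^1(T^{\rm ps})$) such that $\operatorname{div}v=p$. Likewise, for each $v\in\mathring L_r^1(T^{\rm ps})$ (resp., $v\in L_r^1(T^{\rm ps})$) there exists $z\in\mathring S_{r+1}^0(T^{\rm ps})$ (resp., $z\in S_{r+1}^0(T^{\rm ps})$) such that $\operatorname{rot}z=v$.
   Context: Here $r$ is a nonnegative integer. Let $T\subset\mathbb R^2$ be a triangle with vertices $z_1,z_2,z_3$, labelled counter-clockwise, and let $z_0$ be an interior point of $T$. Let $e_i=[z_{i+1},z_{i+2}]$ (indices $1,2,3$ modulo $3$) be the edge of $T$ opposite $z_i$, and let $z_{3+i}$ be an interior point of the edge $e_i$, $i=1,2,3$. The Powell--Sabin split $T^{\rm ps}=\{T_1,\dots,T_6\}$ is the triangulation of $T$ obtained by connecting $z_0$ to each of $z_1,\dots,z_6$. For scalar $q$, $\operatorname{rot}q=(\partial q/\partial x_2,-\partial q/\partial x_1)^\top$; for vector $v$, $\operatorname{div}v=\partial v_1/\partial x_1+\partial v_2/\partial x_2$. $\mathcal P_r(S)$ is the space of polynomials of degree $\le r$ on $S$, and $\mathcal P_r(T^{\rm ps})=\{q\in L^2(T): q|_S\in\mathcal P_r(S)\ \forall S\in T^{\rm ps}\}$. Define: - $L_r^0(T^{\rm ps})=L_r^2(T^{\rm ps})=\mathcal P_r(T^{\rm ps})\cap C(T)$,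 and $L_r^1(T^{\rm ps})=[L_r^0(T^{\rm ps})]^2$; - $\mathring L_r^1(T^{\rm ps})=\{v\in L_r^1(T^{\rm ps}): v=0\text{ on }\partial T\}$, and $\mathring L_r^2(T^{\rm ps})=\{q\in L_r^2(T^{\rm ps}): q=0 \text{ on }\partial T,\ \int_T q=0\}$; - $S_r^0(T^{\rm ps})=\{v\in L_r^0(T^{\rm ps}):\operatorname{rot}v\in[C(T)]^2\}$, and $\mathring S_r^0(T^{\rm ps})=\{v\in S_r^0(T^{\rm ps}): v=0\text{ and }\operatorname{rot}v=0\text{ on }\partial T\}$; - $S_r^1(T^{\rm ps})=\{v\in L_r^1(T^{\rm ps}):\operatorname{div}v\in C(T)\}$, and $\mathring S_r^1(T^{\rm ps})=\{v\in S_r^1(T^{\rm ps}): v=0\text{ and }\operatorname{div}v=0\text{ on }\partial T\}$.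
   Formalization: In the second sentence (both cases) v is additionally assumed to satisfy div v = 0 on the interior of each T_i; this is necessary for rot z = v, and without it the claim fails for r ≥ 1, e.g. v(x) = x has div v = 2. *)

theory Defs
  imports "HOL-Analysis.Analysis"
begin

text \<open>The six boundary vertices met counter-clockwise along the boundary of the triangle are
  \<open>z 1, z 6, z 2, z 4, z 3, z 5\<close>, because \<open>z (3 + i)\<close> lies on the edge opposite \<open>z i\<close>.\<close>

definition powell_sabin :: "(nat \<Rightarrow> real^2) \<Rightarrow> bool" where
  "powell_sabin z \<longleftrightarrow>
     det (vector [z 2 - z 1, z 3 - z 1] :: real^2^2) > 0 \<and>
     z 0 \<in> interior (convex hull {z 1, z 2, z 3}) \<and>
     z 4 \<in> open_segment (z 2) (z 3) \<and>
     z 5 \<in> open_segment (z 3) (z 1) \<and>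
     z 6 \<in> open_segment (z 1) (z 2)"

definition ps_triangle :: "(nat \<Rightarrow> real^2) \<Rightarrow> (real^2) set" where
  "ps_triangle z = convex hull {z 1, z 2, z 3}"

definition ps_split :: "(nat \<Rightarrow> real^2) \<Rightarrow> (real^2) set set" where
  "ps_split z =
     {convex hull {z 0, z 1, z 6}, convex hull {z 0, z 6, z 2},
      convex hull {z 0, z 2, z 4}, convex hull {z 0, z 4, z 3},
      convex hull {z 0, z 3, z 5}, convex hull {z 0, z 5, z 1}}"

definition bivariate_poly :: "nat \<Rightarrow> (real^2 \<Rightarrow> real) set" where
  "bivariate_poly r =
     {f. \<exists>c. \<forall>x. f x = (\<Sum>i\<le>r. \<Sum>j\<le>r - i. c i j * (x $ 1) ^ i * (x $ 2) ^ j)}"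

text \<open>Functions on the triangle are represented by total functions; every notion below depends
  only on their values on the triangle. Elements of \<open>L\<^sup>2\<close> are compared on the interiors of the six
  subtriangles, which make up the triangle up to a null set. A function that agrees there
  with polynomials is automatically square integrable. Derivatives of piecewise polynomials are
  likewise taken in these interiors.\<close>

definition pw_eq :: "(nat \<Rightarrow> real^2) \<Rightarrow> (real^2 \<Rightarrow> 'a) \<Rightarrow> (real^2 \<Rightarrow> 'a) \<Rightarrow> bool" where
  "pw_eq z f g \<longleftrightarrow> (\<forall>S\<in>ps_split z. \<forall>x\<in>interior S. f x = g x)"

definition pw_poly :: "(nat \<Rightarrow> real^2) \<Rightarrow> nat \<Rightarrow> (real^2 \<Rightarrow> real) set" where
  "pw_poly z r =
     {q. \<forall>S\<in>ps_split z. \<exists>f\<in>bivariate_poly r. \<forall>x\<in>interior S. q x = f x}"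

definition partial_deriv :: "2 \<Rightarrow> (real^2 \<Rightarrow> real) \<Rightarrow> real^2 \<Rightarrow> real" where
  "partial_deriv i q x = frechet_derivative q (at x) (axis i 1)"

definition rot :: "(real^2 \<Rightarrow> real) \<Rightarrow> real^2 \<Rightarrow> real^2" where
  "rot q x = vector [partial_deriv 2 q x, - partial_deriv 1 q x]"

definition divergence :: "(real^2 \<Rightarrow> real^2) \<Rightarrow> real^2 \<Rightarrow> real" where
  "divergence v x = partial_deriv 1 (\<lambda>y. v y $ 1) x + partial_deriv 2 (\<lambda>y. v y $ 2) x"

definition L0 :: "(nat \<Rightarrow> real^2) \<Rightarrow> nat \<Rightarrow> (real^2 \<Rightarrow> real) set" where
  "L0 z r = {q \<in> pw_poly z r. continuous_on (ps_triangle z) q}"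

definition L2 :: "(nat \<Rightarrow> real^2) \<Rightarrow> nat \<Rightarrow> (real^2 \<Rightarrow> real) set" where
  "L2 z r = L0 z r"

definition L1 :: "(nat \<Rightarrow> real^2) \<Rightarrow> nat \<Rightarrow> (real^2 \<Rightarrow> real^2) set" where
  "L1 z r = {v. \<forall>i. (\<lambda>x. v x $ i) \<in> L0 z r}"

definition L1_ring :: "(nat \<Rightarrow> real^2) \<Rightarrow> nat \<Rightarrow> (real^2 \<Rightarrow> real^2) set" where
  "L1_ring z r = {v \<in> L1 z r. \<forall>x\<in>frontier (ps_triangle z). v x = 0}"

definition L2_ring :: "(nat \<Rightarrow> real^2) \<Rightarrow> nat \<Rightarrow> (real^2 \<Rightarrow> real) set" where
  "L2_ring z r =
     {q \<in> L2 z r. (\<forall>x\<in>frontier (ps_triangle z). q x = 0) \<and> integral (ps_triangle z) q = 0}"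

text \<open>\<open>rot v\<close> and \<open>divergence v\<close> are meaningful only in the interiors of the subtriangles. Hence
  continuity on the closed triangle, and values on its boundary, refer to the continuous
  function \<open>w\<close> that agrees with them there.\<close>

definition S0 :: "(nat \<Rightarrow> real^2) \<Rightarrow> nat \<Rightarrow> (real^2 \<Rightarrow> real) set" where
  "S0 z r = {v \<in> L0 z r. \<exists>w. continuous_on (ps_triangle z) w \<and> pw_eq z (rot v) w}"

definition S0_ring :: "(nat \<Rightarrow> real^2) \<Rightarrow> nat \<Rightarrow> (real^2 \<Rightarrow> real) set" where
  "S0_ring z r =
     {v \<in> S0 z r. (\<forall>x\<in>frontier (ps_triangle z). v x = 0) \<and>
        (\<exists>w. continuous_on (ps_triangle z) w \<and> pw_eq z (rot v) w \<and>
             (\<forall>x\<in>frontier (ps_triangle z). w x = 0))}"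

definition S1 :: "(nat \<Rightarrow> real^2) \<Rightarrow> nat \<Rightarrow> (real^2 \<Rightarrow> real^2) set" where
  "S1 z r = {v \<in> L1 z r. \<exists>w. continuous_on (ps_triangle z) w \<and> pw_eq z (divergence v) w}"

definition S1_ring :: "(nat \<Rightarrow> real^2) \<Rightarrow> nat \<Rightarrow> (real^2 \<Rightarrow> real^2) set" where
  "S1_ring z r =
     {v \<in> S1 z r. (\<forall>x\<in>frontier (ps_triangle z). v x = 0) \<and>
        (\<exists>w. continuous_on (ps_triangle z) w \<and> pw_eq z (divergence v) w \<and>
             (\<forall>x\<in>frontier (ps_triangle z). w x = 0))}"

end

theory Submission
  imports Defs
begin

text \<open>On each of the six sectors around \<open>z 0\<close> a piecewise polynomial splits into parts that are
  homogeneous in \<open>y = x - z 0\<close>, and continuity across the interior edges is inherited by every part.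
  Euler's identity then inverts \<open>div\<close> by the radial field \<open>\<Sum>\<^sub>k (p\<^sub>k / (k + 2)) y\<close>, and \<open>rot\<close> by
  \<open>\<Sum>\<^sub>k (y\<^sub>2 v\<^sub>1\<^sub>k - y\<^sub>1 v\<^sub>2\<^sub>k) / (k + 1)\<close>; the latter is constant on the boundary if \<open>v\<close> vanishes there.

  For \<open>div\<close> with boundary conditions, let \<open>\<mu>\<close> be the hat function of \<open>z 0\<close>. If \<open>g\<close> is homogeneous of degree
  \<open>k > 0\<close>, there is a continuous homogeneous \<open>w\<close> with \<open>(m + 1) \<nabla>\<mu> \<bullet> w = g\<close>, and its tangential part
  can be chosen such that \<open>div w\<close> is continuous across the edges towards \<open>z 4, z 5, z 6\<close>, where
  \<open>\<nabla>\<mu>\<close> does not jump. So \<open>\<mu>\<^sup>m g = div (\<mu>\<^sup>m\<^sup>+\<^sup>1 w) - \<mu>\<^sup>m\<^sup>+\<^sup>1 div w\<close> lowers \<open>k\<close>. At \<open>k = 0\<close> a constant \<open>w\<close>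
  meets two of the three conditions, and the mean value of \<open>p\<close> takes care of the third.\<close>

section \<open>Partial derivatives and bivariate polynomials\<close>

text \<open>The lowering step rests on the position of \<open>z 4\<close>, \<open>z 5\<close>,
  \<open>z 6\<close> on the edges of the large triangle: the gradient of the hat function takes only
  three values. Across the edges towards \<open>z 1\<close>, \<open>z 2\<close>, \<open>z 3\<close>
  the two neighbouring values are linearly independent, so there a common value of \<open>w\<close>
  can be found even if \<open>g\<close> jumps. Across the other three edges the gradient is the same
  on both sides, so \<open>g\<close> has to be continuous there, and in exchange the tangential part
  of \<open>w\<close> stays free. Hence the induction carries continuity of \<open>g\<close> across
  these three edges only, which is exactly what can be arranged for \<open>divergence w\<close>.

  The defect left at degree 0 is always a multiple of one fixed function, so the defects of all
  homogeneous parts add up to one scalar. By the divergence theorem, applied to the field extended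
  by 0 to a Lipschitz function on the plane, the integral of the defect equals that of
  \<open>p\<close>. The fixed function is positive inside its sector, so the scalar is 0.

  For \<open>rot\<close>, the field \<open>v\<close> must be divergence-free: \<open>rot q\<close>
  has divergence 0 on every subtriangle, so no other field can be reached.\<close>

lemma partial_deriv_eq:
  "(f has_derivative f') (at x) \<Longrightarrow> partial_deriv i f x = f' (axis i 1)"
  unfolding partial_deriv_def by (metis frechet_derivative_at)

lemma differentiable_partials:
  fixes f :: "real^2 \<Rightarrow> real"
  assumes "f differentiable at x"
  shows "(f has_derivative (\<lambda>h. h $ 1 * partial_deriv 1 f x + h $ 2 * partial_deriv 2 f x)) (at x)"
proof -
  let ?D = "frechet_derivative f (at x)"
  have D: "(f has_derivative ?D) (at x)"
    using assms frechet_derivative_works by blast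
  then have lin: "linear ?D"
    by (rule has_derivative_linear)
  have "?D h = h $ 1 * ?D (axis 1 1) + h $ 2 * ?D (axis 2 1)" for h
  proof -
    have "h = h $ 1 *\<^sub>R axis 1 1 + h $ 2 *\<^sub>R axis 2 1"
      by (simp add: vec_eq_iff forall_2 axis_def)
    then have "?D h = ?D (h $ 1 *\<^sub>R axis 1 1 + h $ 2 *\<^sub>R axis 2 1)"
      by simp
    then show ?thesis
      by (simp add: linear_add[OF lin] linear_scale[OF lin])
  qed
  then have "?D = (\<lambda>h. h $ 1 * partial_deriv 1 f x + h $ 2 * partial_deriv 2 f x)"
    unfolding partial_deriv_def by blast
  with D show ?thesis
    by simp
qed

lemma differentiable_has_derivative:
  "f differentiable at x \<Longrightarrow> (f has_derivative frechet_derivative f (at x)) (at x)"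
  using frechet_derivative_works by blast

lemma partial_deriv_const [simp]: "partial_deriv i (\<lambda>_. c) x = 0"
  by (rule partial_deriv_eq) auto

lemma differentiable_nth [simp]: "(\<lambda>x::real^2. x $ j) differentiable at x"
  by (rule bounded_linear_imp_differentiable) (rule bounded_linear_vec_nth)

lemma partial_deriv_nth [simp]: "partial_deriv i (\<lambda>x. x $ j) x = (if i = j then 1 else 0)"
proof -
  have "((\<lambda>x::real^2. x $ j) has_derivative (\<lambda>x. x $ j)) (at x)"
    by (rule bounded_linear_imp_has_derivative) (rule bounded_linear_vec_nth)
  from partial_deriv_eq[OF this] show ?thesis
    by (auto simp: axis_def)
qed

lemma partial_deriv_add:
  assumes "f differentiable at x" "g differentiable at x"
  shows "partial_deriv i (\<lambda>x. f x + g x) x = partial_deriv i f x + partial_deriv i g x"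
  unfolding partial_deriv_def[of i f] partial_deriv_def[of i g]
  using assms by (intro partial_deriv_eq has_derivative_add differentiable_has_derivative)

lemma partial_deriv_mult:
  assumes "f differentiable at x" "g differentiable at x"
  shows "partial_deriv i (\<lambda>x. f x * g x) x = f x * partial_deriv i g x + partial_deriv i f x * g x"
  unfolding partial_deriv_def[of i f] partial_deriv_def[of i g]
  using assms by (intro partial_deriv_eq has_derivative_mult differentiable_has_derivative)

lemma partial_deriv_cmult:
  assumes "f differentiable at x"
  shows "partial_deriv i (\<lambda>x. c * f x) x = c * partial_deriv i f x"
  using partial_deriv_mult[of "\<lambda>_. c" x f i] assms by simp

lemma partial_deriv_sum:
  assumes "finite I" "\<And>k. k \<in> I \<Longrightarrow> f k differentiable at x"
  shows "partial_deriv i (\<lambda>x. \<Sum>k\<in>I. f k x) x = (\<Sum>k\<in>I. partial_deriv i (f k) x)"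
  using assms(2) unfolding partial_deriv_def[of i "f _"]
  by (intro partial_deriv_eq has_derivative_sum differentiable_has_derivative)

lemma partial_deriv_cong:
  assumes "open U" "x \<in> U" "\<And>y. y \<in> U \<Longrightarrow> f y = g y"
  shows "partial_deriv i f x = partial_deriv i g x"
proof -
  have "(f has_derivative D) (at x) \<longleftrightarrow> (g has_derivative D) (at x)" for D
    using assms has_derivative_transform_within_open[of f D x UNIV U g]
      has_derivative_transform_within_open[of g D x UNIV U f] by auto
  then show ?thesis
    unfolding partial_deriv_def frechet_derivative_def by simp
qed

lemma partial_deriv_translate:
  fixes f :: "real^2 \<Rightarrow> real"
  assumes "f differentiable at (x - a)"
  shows "partial_deriv i (\<lambda>x. f (x - a)) x = partial_deriv i f (x - a)"
proof -
  have "((\<lambda>x. f (x - a)) has_derivative (\<lambda>h. frechet_derivative f (at (x - a)) h)) (at x)"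
    by (rule has_derivative_compose[where f = "\<lambda>x. x - a" and f' = "\<lambda>h. h"])
      (use differentiable_has_derivative[OF assms] in \<open>auto intro!: derivative_eq_intros\<close>)
  from partial_deriv_eq[OF this] show ?thesis
    by (simp add: partial_deriv_def)
qed

lemma divergence_add:
  assumes "\<And>c. (\<lambda>y. v y $ c) differentiable at x" "\<And>c. (\<lambda>y. w y $ c) differentiable at x"
  shows "divergence (\<lambda>x. v x + w x) x = divergence v x + divergence w x"
  using assms by (simp add: divergence_def partial_deriv_add)

lemma divergence_scaleR:
  assumes "f differentiable at x" "\<And>c. (\<lambda>y. v y $ c) differentiable at x"
  shows "divergence (\<lambda>x. f x *\<^sub>R v x) x =
    f x * divergence v x + (\<Sum>c\<in>UNIV. partial_deriv c f x * v x $ c)"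
  using assms by (simp add: divergence_def partial_deriv_mult sum_2 algebra_simps)

lemma divergence_scaleR_const:
  assumes "f differentiable at x"
  shows "divergence (\<lambda>x. f x *\<^sub>R u) x = (\<Sum>c\<in>UNIV. partial_deriv c f x * u $ c)"
  using divergence_scaleR[OF assms, of "\<lambda>_. u"] by (simp add: divergence_def)

section \<open>Homogeneous polynomials and their relation to \<open>bivariate_poly\<close>\<close>

inductive hpoly :: "nat \<Rightarrow> (real^2 \<Rightarrow> real) \<Rightarrow> bool" where
  hpoly_const: "hpoly 0 (\<lambda>_. c)"
| hpoly_nth_mult: "hpoly k f \<Longrightarrow> hpoly (Suc k) (\<lambda>x. x $ i * f x)"
| hpoly_add: "hpoly k f \<Longrightarrow> hpoly k g \<Longrightarrow> hpoly k (\<lambda>x. f x + g x)"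

lemma hpoly_scaleR: "hpoly k f \<Longrightarrow> f (t *\<^sub>R x) = t ^ k * f x"
  by (induction rule: hpoly.induct) (auto simp: algebra_simps)

lemma hpoly_differentiable [simp]: "hpoly k f \<Longrightarrow> f differentiable at x"
  by (induction rule: hpoly.induct) auto

lemma hpoly_cmult: "hpoly k f \<Longrightarrow> hpoly k (\<lambda>x. c * f x)"
proof (induction rule: hpoly.induct)
  case (hpoly_const d)
  then show ?case using hpoly.hpoly_const[of "c * d"] by simp
next
  case (hpoly_nth_mult k f i)
  then show ?case using hpoly.hpoly_nth_mult[of k "\<lambda>x. c * f x" i] by (simp add: mult.left_commute)
next
  case (hpoly_add k f g)
  then show ?case using hpoly.hpoly_add by (simp add: distrib_left)
qed

lemma hpoly_zero: "hpoly k (\<lambda>_. 0)"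
proof (induction k)
  case 0
  show ?case by (rule hpoly_const)
next
  case (Suc k)
  from hpoly_nth_mult[OF this] show ?case by simp
qed

lemma hpoly_sum:
  assumes "\<And>i. i \<in> I \<Longrightarrow> hpoly k (f i)"
  shows "hpoly k (\<lambda>x. \<Sum>i\<in>I. f i x)"
proof (cases "finite I")
  case True
  then show ?thesis
    using assms by (induction I rule: finite_induct) (auto intro: hpoly_zero hpoly_add)
qed (simp add: hpoly_zero)

lemma hpoly_mult: "hpoly k f \<Longrightarrow> hpoly l g \<Longrightarrow> hpoly (k + l) (\<lambda>x. f x * g x)"
  by (induction rule: hpoly.induct)
    (auto simp: distrib_right mult.assoc intro: hpoly_cmult hpoly_nth_mult hpoly_add)

lemma hpoly_nth: "hpoly 1 (\<lambda>x. x $ i)"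
  using hpoly_nth_mult[OF hpoly_const[of 1], of i] by simp

lemma hpoly_inner: "hpoly 1 (\<lambda>x. u \<bullet> x)"
  unfolding inner_vec_def by (auto intro!: hpoly_sum hpoly_cmult hpoly_nth[simplified])

lemma hpoly_power: "hpoly k f \<Longrightarrow> hpoly (k * m) (\<lambda>x. f x ^ m)"
proof (induction m)
  case 0
  show ?case using hpoly_const[of 1] by simp
next
  case (Suc m)
  then show ?case using hpoly_mult[of k f "k * m" "\<lambda>x. f x ^ m"] by simp
qed

text \<open>Both cases are carried through one induction: in the product rule the factor
  \<open>f\<close> may have degree 0, and then its derivative must vanish for
  \<open>x $ j * partial_deriv i f x\<close> to have degree \<open>k\<close>.\<close>

lemma hpoly_partial_deriv_aux:
  "hpoly k f \<Longrightarrow>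
    (k = 0 \<longrightarrow> partial_deriv i f = (\<lambda>_. 0)) \<and> (\<forall>l. k = Suc l \<longrightarrow> hpoly l (partial_deriv i f))"
proof (induction rule: hpoly.induct)
  case (hpoly_const c)
  then show ?case by (auto simp: fun_eq_iff)
next
  case (hpoly_nth_mult k f j)
  have eq: "partial_deriv i (\<lambda>x. x $ j * f x) =
      (\<lambda>x. x $ j * partial_deriv i f x + (if i = j then 1 else 0) * f x)"
    using hpoly_nth_mult.hyps by (simp add: fun_eq_iff partial_deriv_mult)
  have "hpoly k (\<lambda>x. x $ j * partial_deriv i f x)"
  proof (cases k)
    case 0
    then show ?thesis using hpoly_nth_mult.IH hpoly_const[of 0] by simp
  next
    case (Suc l)
    then show ?thesis using hpoly_nth_mult.IH hpoly.hpoly_nth_mult by simp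
  qed
  then show ?case
    unfolding eq using hpoly_nth_mult.hyps by (auto intro: hpoly_add hpoly_zero)
next
  case (hpoly_add k f g)
  have "partial_deriv i (\<lambda>x. f x + g x) = (\<lambda>x. partial_deriv i f x + partial_deriv i g x)"
    using hpoly_add.hyps by (simp add: fun_eq_iff partial_deriv_add)
  then show ?case
    using hpoly_add.IH by (auto intro: hpoly.hpoly_add)
qed

lemma hpoly_partial_deriv: "hpoly (Suc k) f \<Longrightarrow> hpoly k (partial_deriv i f)"
  using hpoly_partial_deriv_aux by blast

lemma hpoly_0_partial_deriv: "hpoly 0 f \<Longrightarrow> partial_deriv i f x = 0"
  using hpoly_partial_deriv_aux[of 0 f i] by simp

lemma hpoly_euler:
  "hpoly k f \<Longrightarrow> x $ 1 * partial_deriv 1 f x + x $ 2 * partial_deriv 2 f x = of_nat k * f x"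
proof (induction rule: hpoly.induct)
  case (hpoly_nth_mult k f i)
  have "x $ 1 * partial_deriv 1 (\<lambda>x. x $ i * f x) x + x $ 2 * partial_deriv 2 (\<lambda>x. x $ i * f x) x =
      x $ i * (x $ 1 * partial_deriv 1 f x + x $ 2 * partial_deriv 2 f x) + x $ i * f x"
    using hpoly_nth_mult.hyps exhaust_2[of i] by (auto simp: partial_deriv_mult distrib_left mult_ac)
  then show ?case
    unfolding hpoly_nth_mult.IH by (simp add: algebra_simps)
qed (auto simp: partial_deriv_add algebra_simps)

lemma hpoly_coeffs:
  "hpoly k f \<Longrightarrow> \<exists>c. \<forall>x. f x = (\<Sum>i\<le>k. c i * ((x $ 1) ^ i * (x $ 2) ^ (k - i)))"
proof (induction rule: hpoly.induct)
  case (hpoly_const a)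
  show ?case by (rule exI[of _ "\<lambda>_. a"]) simp
next
  case (hpoly_nth_mult k f l)
  then obtain c where c: "\<And>x. f x = (\<Sum>i\<le>k. c i * ((x $ 1) ^ i * (x $ 2) ^ (k - i)))"
    by blast
  have "l = 1 \<or> l = 2"
    using exhaust_2 by blast
  then show ?case
  proof
    assume l: "l = 1"
    show ?thesis
      \<comment> \<open>Multiplication by \<open>x $ 1\<close> raises every exponent of the first
        variable by one, so the coefficients shift.\<close>
      by (rule exI[of _ "case_nat 0 c"])
        (simp add: l c sum.atMost_Suc_shift sum_distrib_left algebra_simps del: sum.atMost_Suc)
  next
    assume l: "l = 2"
    \<comment> \<open>Multiplication by \<open>x $ 2\<close> keeps the exponents of the first
      variable; the new top index \<open>Suc k\<close> gets coefficient 0.\<close>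
    have "x $ 2 * f x = (\<Sum>i\<le>Suc k. (if i \<le> k then c i else 0) * ((x $ 1) ^ i * (x $ 2) ^ (Suc k - i)))"
      for x
      by (simp add: c sum_distrib_left Suc_diff_le algebra_simps)
    then show ?thesis unfolding l by (intro exI allI)
  qed
next
  case (hpoly_add k f g)
  then obtain c d where
    "\<And>x. f x = (\<Sum>i\<le>k. c i * ((x $ 1) ^ i * (x $ 2) ^ (k - i)))"
    "\<And>x. g x = (\<Sum>i\<le>k. d i * ((x $ 1) ^ i * (x $ 2) ^ (k - i)))"
    by blast
  then show ?case
    by (intro exI[of _ "\<lambda>i. c i + d i"]) (simp add: distrib_right sum.distrib)
qed

text \<open>Regroups the index triangle by total degree \<open>k = i + j\<close>, the passage
  between \<open>bivariate_poly\<close> and homogeneous parts.\<close>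

lemma sum_triangle_real:
  fixes c :: "nat \<Rightarrow> nat \<Rightarrow> real"
  shows "(\<Sum>i\<le>r. \<Sum>j\<le>r - i. c i j) = (\<Sum>k\<le>r. \<Sum>i\<le>k. c i (k - i))"
proof -
  have "(SIGMA i:{..r}. {..r - i}) = {(i, j). i + j \<le> r}"
    by auto
  then show ?thesis
    using sum.triangle_reindex_eq[of c r] by (simp add: sum.Sigma)
qed

lemma bivariate_poly_decompose:
  assumes "f \<in> bivariate_poly r"
  obtains h where "\<And>k. hpoly k (h k)" "\<And>x. f x = (\<Sum>k\<le>r. h k x)"
proof -
  obtain c where c: "\<And>x. f x = (\<Sum>i\<le>r. \<Sum>j\<le>r - i. c i j * (x $ 1) ^ i * (x $ 2) ^ j)"
    using assms unfolding bivariate_poly_def by blast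
  define h where "h k x = (\<Sum>i\<le>k. c i (k - i) * ((x $ 1) ^ i * (x $ 2) ^ (k - i)))" for k and x :: "real^2"
  have "hpoly k (h k)" for k
    unfolding h_def
  proof (intro hpoly_sum hpoly_cmult)
    fix i assume "i \<in> {..k}"
    then show "hpoly k (\<lambda>x. (x $ 1) ^ i * (x $ 2) ^ (k - i))"
      using hpoly_mult[OF hpoly_power[OF hpoly_nth[of 1], of i] hpoly_power[OF hpoly_nth[of 2], of "k - i"]]
      by simp
  qed
  moreover have "f x = (\<Sum>k\<le>r. h k x)" for x
    unfolding c h_def by (simp only: sum_triangle_real mult.assoc)
  ultimately show ?thesis
    using that by blast
qed

lemma hpoly_sum_bivariate:
  assumes "\<And>k. k \<le> r \<Longrightarrow> hpoly k (h k)"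
  shows "(\<lambda>x. \<Sum>k\<le>r. h k x) \<in> bivariate_poly r"
proof -
  have "\<forall>k. \<exists>c. k \<le> r \<longrightarrow> (\<forall>x. h k x = (\<Sum>i\<le>k. c i * ((x $ 1) ^ i * (x $ 2) ^ (k - i))))"
    using assms hpoly_coeffs by blast
  then obtain c where
    c: "\<And>k x. k \<le> r \<Longrightarrow> h k x = (\<Sum>i\<le>k. c k i * ((x $ 1) ^ i * (x $ 2) ^ (k - i)))"
    by metis
  have "(\<Sum>k\<le>r. h k x) = (\<Sum>i\<le>r. \<Sum>j\<le>r - i. c (i + j) i * (x $ 1) ^ i * (x $ 2) ^ j)" for x
    by (simp add: sum_triangle_real c mult.assoc)
  then show ?thesis
    unfolding bivariate_poly_def by (intro CollectI exI[of _ "\<lambda>i j. c (i + j) i"]) blast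
qed

lemma bivariate_poly_add:
  assumes "f \<in> bivariate_poly r" "g \<in> bivariate_poly r"
  shows "(\<lambda>x. f x + g x) \<in> bivariate_poly r"
proof -
  obtain h h' where h: "\<And>k. hpoly k (h k)" "\<And>x. f x = (\<Sum>k\<le>r. h k x)"
    and h': "\<And>k. hpoly k (h' k)" "\<And>x. g x = (\<Sum>k\<le>r. h' k x)"
    using bivariate_poly_decompose assms by metis
  show ?thesis
    using hpoly_sum_bivariate[of r "\<lambda>k x. h k x + h' k x"] h(1) h'(1)
    by (simp add: hpoly_add h(2) h'(2) sum.distrib)
qed

lemma bivariate_poly_mono:
  assumes "f \<in> bivariate_poly r" "r \<le> s"
  shows "f \<in> bivariate_poly s"
proof -
  obtain h where h: "\<And>k. hpoly k (h k)" "\<And>x. f x = (\<Sum>k\<le>r. h k x)"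
    using bivariate_poly_decompose assms by metis
  have "f = (\<lambda>x. \<Sum>k\<le>s. if k \<le> r then h k x else 0)"
    unfolding h(2) fun_eq_iff using assms(2) by (auto intro!: sum.mono_neutral_cong_left split: if_splits)
  moreover have "hpoly k (\<lambda>x. if k \<le> r then h k x else 0)" for k
    using h(1) by (cases "k \<le> r") (auto intro: hpoly_zero)
  ultimately show ?thesis
    by (auto intro: hpoly_sum_bivariate)
qed

lemma hpoly_bivariate:
  assumes "hpoly k f" "k \<le> r"
  shows "f \<in> bivariate_poly r"
proof (rule bivariate_poly_mono)
  have "hpoly l (\<lambda>x. if l = k then f x else 0)" for l
    using assms(1) by (cases "l = k") (auto intro: hpoly_zero)
  from hpoly_sum_bivariate[OF this, of k] show "f \<in> bivariate_poly k"
    by simp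
qed (fact assms(2))

lemma bivariate_poly_const: "(\<lambda>_. a) \<in> bivariate_poly r"
  by (rule hpoly_bivariate) (auto intro: hpoly_const)

lemma bivariate_poly_cmult:
  assumes "f \<in> bivariate_poly r"
  shows "(\<lambda>x. a * f x) \<in> bivariate_poly r"
proof -
  obtain h where h: "\<And>k. hpoly k (h k)" "\<And>x. f x = (\<Sum>k\<le>r. h k x)"
    using bivariate_poly_decompose assms by metis
  show ?thesis
    unfolding h(2) sum_distrib_left by (intro hpoly_sum_bivariate hpoly_cmult h(1))
qed

lemma bivariate_poly_nth_mult:
  assumes "f \<in> bivariate_poly r"
  shows "(\<lambda>x. x $ l * f x) \<in> bivariate_poly (Suc r)"
proof -
  obtain h where h: "\<And>k. hpoly k (h k)" "\<And>x. f x = (\<Sum>k\<le>r. h k x)"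
    using bivariate_poly_decompose assms by metis
  have "(\<lambda>x. \<Sum>k\<le>Suc r. case k of 0 \<Rightarrow> 0 | Suc k \<Rightarrow> x $ l * h k x) \<in> bivariate_poly (Suc r)"
  proof (rule hpoly_sum_bivariate)
    show "hpoly k (\<lambda>x. case k of 0 \<Rightarrow> 0 | Suc k \<Rightarrow> x $ l * h k x)" for k
      by (cases k) (simp_all add: h(1) hpoly_zero hpoly_nth_mult)
  qed
  then show ?thesis
    by (simp add: h(2) sum.atMost_Suc_shift sum_distrib_left del: sum.atMost_Suc)
qed

lemma bivariate_poly_sum:
  assumes "\<And>i. i \<in> I \<Longrightarrow> f i \<in> bivariate_poly r"
  shows "(\<lambda>x. \<Sum>i\<in>I. f i x) \<in> bivariate_poly r"
proof (cases "finite I")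
  case True
  then show ?thesis
    using assms
    by (induction I rule: finite_induct) (auto intro: bivariate_poly_const bivariate_poly_add)
qed (simp add: bivariate_poly_const)

lemma bivariate_poly_affine_mult:
  assumes "f \<in> bivariate_poly r"
  shows "(\<lambda>x. (a + u \<bullet> x) * f x) \<in> bivariate_poly (Suc r)"
proof -
  have eq: "(\<lambda>x. (a + u \<bullet> x) * f x) = (\<lambda>x. a * f x + (\<Sum>i\<in>UNIV. u $ i * (x $ i * f x)))"
    by (simp add: inner_vec_def distrib_right sum_distrib_right mult.assoc)
  show ?thesis
    unfolding eq
    by (intro bivariate_poly_add bivariate_poly_sum bivariate_poly_cmult
        bivariate_poly_nth_mult[OF assms] bivariate_poly_mono[OF assms]) simp
qed

lemma bivariate_poly_affine_power_mult:
  assumes "f \<in> bivariate_poly r"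
  shows "(\<lambda>x. (a + u \<bullet> x) ^ m * f x) \<in> bivariate_poly (m + r)"
proof (induction m)
  case (Suc m)
  from bivariate_poly_affine_mult[OF this, of a u] show ?case by (simp add: mult.assoc)
qed (simp add: assms)

lemma hpoly_translate_bivariate: "hpoly k f \<Longrightarrow> (\<lambda>x. f (x - a)) \<in> bivariate_poly k"
proof (induction rule: hpoly.induct)
  case (hpoly_nth_mult k f i)
  have eq: "(\<lambda>x. (x - a) $ i * f (x - a)) = (\<lambda>x. (- a $ i + axis i 1 \<bullet> x) * f (x - a))"
    by (simp add: inner_axis')
  show ?case
    unfolding eq by (rule bivariate_poly_affine_mult) (rule hpoly_nth_mult.IH)
qed (auto intro: bivariate_poly_const bivariate_poly_add)

lemma bivariate_poly_translate:
  assumes "f \<in> bivariate_poly r"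
  shows "(\<lambda>x. f (x - a)) \<in> bivariate_poly r"
proof -
  obtain h where h: "\<And>k. hpoly k (h k)" "\<And>x. f x = (\<Sum>k\<le>r. h k x)"
    using bivariate_poly_decompose[OF assms] by blast
  show ?thesis
    unfolding h(2)
    by (intro bivariate_poly_sum bivariate_poly_mono[OF hpoly_translate_bivariate[OF h(1)]]) simp
qed

lemma bivariate_poly_differentiable [simp]:
  assumes "f \<in> bivariate_poly r"
  shows "f differentiable at x"
proof -
  obtain h where h: "\<And>k. hpoly k (h k)" "\<And>x. f x = (\<Sum>k\<le>r. h k x)"
    using bivariate_poly_decompose[OF assms] by blast
  have "f = (\<lambda>x. \<Sum>k\<le>r. h k x)"
    using h(2) by blast
  then show ?thesis
    by (auto intro!: differentiable_sum hpoly_differentiable[OF h(1)])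
qed

lemma bivariate_poly_continuous: "f \<in> bivariate_poly r \<Longrightarrow> continuous_on S f"
  by (simp add: continuous_at_imp_continuous_on differentiable_imp_continuous_within)

lemma bivariate_poly_partial_deriv:
  assumes "f \<in> bivariate_poly r"
  shows "partial_deriv i f \<in> bivariate_poly r"
proof -
  obtain h where h: "\<And>k. hpoly k (h k)" "\<And>x. f x = (\<Sum>k\<le>r. h k x)"
    using bivariate_poly_decompose[OF assms] by blast
  have f: "f = (\<lambda>x. \<Sum>k\<le>r. h k x)"
    using h(2) by blast
  have eq: "partial_deriv i f = (\<lambda>x. \<Sum>k\<le>r. partial_deriv i (h k) x)"
    unfolding f by (rule ext) (simp add: partial_deriv_sum hpoly_differentiable[OF h(1)])
  have "partial_deriv i (h k) \<in> bivariate_poly r" if "k \<le> r" for k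
  proof (cases k)
    case 0
    with h(1)[of k] have "partial_deriv i (h k) = (\<lambda>_. 0)"
      by (auto simp: fun_eq_iff hpoly_0_partial_deriv)
    then show ?thesis by (simp add: bivariate_poly_const)
  next
    case (Suc l)
    with h(1)[of k] have "hpoly l (partial_deriv i (h k))"
      by (auto intro: hpoly_partial_deriv)
    then show ?thesis
      using Suc that by (auto intro: hpoly_bivariate)
  qed
  then show ?thesis
    unfolding eq by (auto intro: bivariate_poly_sum)
qed

text \<open>A nonzero polynomial in one variable has finitely many roots. With \<open>t\<close> as
  parameter along a ray from the centre, this separates the homogeneous parts of a piece.\<close>

lemma power_sum_coeff_eq:
  fixes c d :: "nat \<Rightarrow> real"
  assumes "\<And>t. 0 < t \<Longrightarrow> t < 1 \<Longrightarrow> (\<Sum>k\<le>r. c k * t ^ k) = (\<Sum>k\<le>r. d k * t ^ k)" "k \<le> r"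
  shows "c k = d k"
proof -
  have "{0<..<1::real} \<subseteq> {t. (\<Sum>k\<le>r. (c k - d k) * t ^ k) = 0}"
    using assms(1) by (auto simp: left_diff_distrib sum_subtractf)
  then have "infinite {t. (\<Sum>k\<le>r. (c k - d k) * t ^ k) = 0}"
    by (rule infinite_super) (simp add: infinite_Ioo)
  then have "c k - d k = 0"
    using assms(2) by (simp add: polyfun_finite_roots)
  then show ?thesis by simp
qed

section \<open>The cross product in the plane\<close>

definition cross2 :: "real^2 \<Rightarrow> real^2 \<Rightarrow> real" where
  "cross2 x y = x $ 1 * y $ 2 - x $ 2 * y $ 1"

lemma inner_2: "(x::real^2) \<bullet> y = x $ 1 * y $ 1 + x $ 2 * y $ 2"
  by (simp add: inner_vec_def sum_2)

lemma cross2_simps: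
  "cross2 (x + y) w = cross2 x w + cross2 y w" "cross2 w (x + y) = cross2 w x + cross2 w y"
  "cross2 (x - y) w = cross2 x w - cross2 y w" "cross2 w (x - y) = cross2 w x - cross2 w y"
  "cross2 (c *\<^sub>R x) w = c * cross2 x w" "cross2 w (c *\<^sub>R x) = c * cross2 w x"
  "cross2 (- x) w = - cross2 x w" "cross2 w (- x) = - cross2 w x"
  "cross2 x x = 0"
  by (simp_all add: cross2_def algebra_simps)

lemma cross2_commute: "cross2 y x = - cross2 x y"
  by (simp add: cross2_def)

lemma cross2_0 [simp]: "cross2 0 x = 0" "cross2 x 0 = 0"
  by (simp_all add: cross2_def)

text \<open>Cramer's rule with the denominator cleared; for a basis \<open>u\<close>,
  \<open>v\<close> it yields the coordinates of \<open>x\<close>.\<close>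

lemma cross2_expand: "cross2 u v *\<^sub>R x = cross2 x v *\<^sub>R u + cross2 u x *\<^sub>R v"
  by (simp add: vec_eq_iff forall_2 cross2_def algebra_simps)

text \<open>The Binet-Cauchy identity in the plane.\<close>

lemma cross2_mult_inner: "cross2 n m * cross2 x y = (n \<bullet> x) * (m \<bullet> y) - (n \<bullet> y) * (m \<bullet> x)"
  by (simp add: inner_2 cross2_def algebra_simps)

lemma cross2_solve:
  assumes "cross2 n m \<noteq> 0"
  obtains w :: "real^2" where "n \<bullet> w = a" "m \<bullet> w = b"
proof
  let ?w = "vector [(a * m $ 2 - b * n $ 2) / cross2 n m, (b * n $ 1 - a * m $ 1) / cross2 n m] :: real^2"
  have "n $ 1 * (a * m $ 2 - b * n $ 2) + n $ 2 * (b * n $ 1 - a * m $ 1) = a * cross2 n m"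
    "m $ 1 * (a * m $ 2 - b * n $ 2) + m $ 2 * (b * n $ 1 - a * m $ 1) = b * cross2 n m"
    by (simp_all add: cross2_def algebra_simps)
  then show "n \<bullet> ?w = a" "m \<bullet> ?w = b"
    using assms by (simp_all add: inner_2 flip: add_divide_distrib)
qed

lemma inner_zero_parallel:
  assumes "n \<bullet> x = 0" "n \<bullet> t = 0" "n \<noteq> 0" "cross2 a t \<noteq> 0"
  shows "x = (cross2 a x / cross2 a t) *\<^sub>R t"
proof -
  \<comment> \<open>The auxiliary vector is \<open>n\<close> turned by a right angle, so its cross
    product with \<open>n\<close> is \<open>n \<bullet> n\<close>, which is nonzero.\<close>
  have "cross2 n (vector [- n $ 2, n $ 1]) * cross2 x t = 0"
    by (simp add: cross2_mult_inner assms)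
  moreover have "cross2 n (vector [- n $ 2, n $ 1]) = n \<bullet> n"
    by (simp add: cross2_def inner_2)
  ultimately have "cross2 x t = 0"
    using assms(3) by simp
  with cross2_expand[of a t x] have "cross2 a t *\<^sub>R x = cross2 a x *\<^sub>R t"
    by simp
  then have "(1 / cross2 a t) *\<^sub>R (cross2 a t *\<^sub>R x) = (1 / cross2 a t) *\<^sub>R (cross2 a x *\<^sub>R t)"
    by simp
  then show ?thesis
    using assms(4) by simp
qed

section \<open>Homogeneous vector fields and lifting across one edge\<close>

definition hpoly_vec :: "nat \<Rightarrow> (real^2 \<Rightarrow> real^2) \<Rightarrow> bool" where
  "hpoly_vec k w \<longleftrightarrow> (\<forall>c. hpoly k (\<lambda>x. w x $ c))"

lemma hpoly_vec_nth: "hpoly_vec k w \<Longrightarrow> hpoly k (\<lambda>x. w x $ c)"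
  by (simp add: hpoly_vec_def)

lemma hpoly_vec_differentiable: "hpoly_vec k w \<Longrightarrow> (\<lambda>x. w x $ c) differentiable at x"
  by (rule hpoly_differentiable) (rule hpoly_vec_nth)

lemma hpoly_vec_scaleR: "hpoly_vec k w \<Longrightarrow> w (t *\<^sub>R x) = t ^ k *\<^sub>R w x"
  by (simp add: vec_eq_iff hpoly_scaleR[OF hpoly_vec_nth])

lemma hpoly_vec_scaleR_const: "hpoly k f \<Longrightarrow> hpoly_vec k (\<lambda>x. f x *\<^sub>R u)"
  unfolding hpoly_vec_def by (simp add: mult.commute[of _ "u $ _"] hpoly_cmult)

lemma hpoly_vec_add: "hpoly_vec k v \<Longrightarrow> hpoly_vec k w \<Longrightarrow> hpoly_vec k (\<lambda>x. v x + w x)"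
  unfolding hpoly_vec_def by (simp add: hpoly_add)

lemma hpoly_divergence:
  assumes "hpoly_vec (Suc k) w"
  shows "hpoly k (divergence w)"
proof -
  have "hpoly k (\<lambda>x. partial_deriv 1 (\<lambda>x. w x $ 1) x + partial_deriv 2 (\<lambda>x. w x $ 2) x)"
    by (intro hpoly_add hpoly_partial_deriv hpoly_vec_nth assms)
  then show ?thesis
    by (simp add: divergence_def [abs_def])
qed

lemma partial_deriv_affine_power:
  "partial_deriv i (\<lambda>x. (a + u \<bullet> x) ^ m) x = of_nat m * (a + u \<bullet> x) ^ (m - 1) * u $ i"
proof -
  have "((\<lambda>x. (a + u \<bullet> x) ^ m) has_derivative
      (\<lambda>h. of_nat m * (u \<bullet> h) * (a + u \<bullet> x) ^ (m - 1))) (at x)"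
    by (rule derivative_eq_intros refl | simp)+
  from partial_deriv_eq[OF this] show ?thesis
    by (simp add: inner_axis)
qed

lemma differentiable_affine_power: "(\<lambda>x::real^2. (a + u \<bullet> x) ^ m) differentiable at x"
  by (intro differentiable_power differentiable_add differentiable_const
      bounded_linear_imp_differentiable bounded_linear_inner_right)

lemma divergence_affine_power_scaleR:
  assumes "\<And>c. (\<lambda>y. v y $ c) differentiable at x"
  shows "divergence (\<lambda>x. (a + u \<bullet> x) ^ m *\<^sub>R v x) x =
    (a + u \<bullet> x) ^ m * divergence v x + of_nat m * (a + u \<bullet> x) ^ (m - 1) * (u \<bullet> v x)"
  by (subst divergence_scaleR[OF differentiable_affine_power assms])
    (simp add: partial_deriv_affine_power sum_2 inner_2[of u "v x"] algebra_simps)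

text \<open>Along the edge direction \<open>t\<close> a multiple of \<open>t\<close> is invisible to \<open>n\<close>. It is spent on the
  prescribed value at \<open>P\<close> and, through the parameter \<open>e\<close>, on the divergence at \<open>M\<close>.\<close>

lemma half_lift:
  fixes P M t n a :: "real^2" and g :: "real^2 \<Rightarrow> real"
  assumes g: "hpoly k g" and k: "k > 0"
    and "cross2 P M \<noteq> 0" "n \<bullet> t = 0" "n \<bullet> M = -1" "n \<bullet> a = g P" "cross2 P t \<noteq> 0"
  obtains w X where "\<And>e. hpoly_vec k (w e)" "\<And>e y. n \<bullet> w e y = g y" "\<And>e. w e P = a"
    "\<And>e. w e M = - g M *\<^sub>R M + e *\<^sub>R t"
    "\<And>e. divergence (w e) M = X + e * (of_nat k * cross2 P t / cross2 P M)"
proof -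
  define d where "d = cross2 P M"
  \<comment> \<open>\<open>\<alpha>\<close> and \<open>\<beta>\<close> are the coordinates with
    respect to the basis \<open>P\<close>, \<open>M\<close>.\<close>
  define \<alpha> where "\<alpha> y = cross2 y M / d" for y
  define \<beta> where "\<beta> y = cross2 P y / d" for y
  have \<alpha>: "hpoly 1 \<alpha>"
    using hpoly_inner[of "vector [M $ 2 / d, - M $ 1 / d]"]
    by (simp add: \<alpha>_def[abs_def] cross2_def inner_2 field_simps diff_divide_distrib)
  have \<beta>_inner: "\<beta> = (\<lambda>y. 0 + vector [- P $ 2 / d, P $ 1 / d] \<bullet> y)"
    by (simp add: \<beta>_def[abs_def] cross2_def inner_2 field_simps diff_divide_distrib)
  have \<beta>: "hpoly 1 \<beta>"
    unfolding \<beta>_inner using hpoly_inner by simp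
  have d: "d \<noteq> 0"
    using assms by (simp add: d_def)
  have vals: "\<alpha> P = 1" "\<alpha> M = 0" "\<beta> P = 0" "\<beta> M = 1"
    using d by (simp_all add: \<alpha>_def \<beta>_def cross2_simps flip: d_def)
  have n: "n \<noteq> 0"
    using assms by auto
  \<comment> \<open>The prescribed value \<open>a\<close> and the default value
    \<open>- g P *\<^sub>R M\<close> at \<open>P\<close> have the same product with
    \<open>n\<close>, so they differ by a multiple of \<open>t\<close>.\<close>
  define s where "s = cross2 P (a + g P *\<^sub>R M) / cross2 P t"
  have s: "a + g P *\<^sub>R M = s *\<^sub>R t"
    unfolding s_def using assms n by (intro inner_zero_parallel[of n]) (auto simp: inner_simps)
  \<comment> \<open>\<open>- M\<close> carries the normal part because
    \<open>n \<bullet> M = -1\<close>. As \<open>k > 0\<close>, the power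
    \<open>\<alpha> y ^ k\<close> is 1 at \<open>P\<close> and 0 at \<open>M\<close>, so the
    correction by \<open>s\<close> leaves the value at \<open>M\<close> alone.\<close>
  define u where "u y = g y *\<^sub>R (- M) + (s * \<alpha> y ^ k) *\<^sub>R t" for y
  \<comment> \<open>Dually, \<open>\<beta> y ^ k\<close> is 0 at \<open>P\<close> and 1 at
    \<open>M\<close>: the parameter \<open>e\<close> moves value and divergence at \<open>M\<close>
    but not the value at \<open>P\<close>.\<close>
  define w where "w e y = u y + (e * \<beta> y ^ k) *\<^sub>R t" for e y
  have u: "hpoly_vec k u"
    unfolding u_def[abs_def]
    using hpoly_power[OF \<alpha>, of k] g
    by (intro hpoly_vec_add hpoly_vec_scaleR_const hpoly_cmult) simp_all
  have bt: "hpoly k (\<lambda>y. e * \<beta> y ^ k)" for e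
    using hpoly_power[OF \<beta>, of k] by (intro hpoly_cmult) simp
  show thesis
  proof
    show "hpoly_vec k (w e)" for e
      unfolding w_def[abs_def] by (intro hpoly_vec_add u hpoly_vec_scaleR_const bt)
    show "n \<bullet> w e y = g y" for e y
      using assms by (simp add: w_def u_def inner_simps)
    show "w e P = a" for e
      using s k by (simp add: w_def u_def vals algebra_simps)
    show "w e M = - g M *\<^sub>R M + e *\<^sub>R t" for e
      using k by (simp add: w_def u_def vals)
    show "divergence (w e) M = divergence u M + e * (of_nat k * cross2 P t / cross2 P M)" for e
    proof -
      have pd: "partial_deriv c (\<lambda>y. e * \<beta> y ^ k) M = e * (of_nat k * (vector [- P $ 2 / d, P $ 1 / d] :: real^2) $ c)" for c
      proof -
        have "(\<lambda>y. \<beta> y ^ k) differentiable at M"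
          using hpoly_power[OF \<beta>, of k] by simp
        from partial_deriv_cmult[OF this, of c e] show ?thesis
          using partial_deriv_affine_power[of c 0 "vector [- P $ 2 / d, P $ 1 / d]" k M] vals(4)
          by (simp add: \<beta>_inner)
      qed
      have "divergence (w e) M = divergence u M + divergence (\<lambda>y. (e * \<beta> y ^ k) *\<^sub>R t) M"
        unfolding w_def[abs_def]
        by (intro divergence_add hpoly_vec_differentiable[OF u]
            hpoly_vec_differentiable[OF hpoly_vec_scaleR_const[OF bt]])
      also have "divergence (\<lambda>y. (e * \<beta> y ^ k) *\<^sub>R t) M = e * (of_nat k * cross2 P t / d)"
        by (subst divergence_scaleR_const[OF hpoly_differentiable[OF bt]])
          (simp add: pd sum_2 cross2_def diff_divide_distrib algebra_simps)
      finally show ?thesis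
        by (simp add: d_def)
    qed
  qed
qed

text \<open>The same \<open>e\<close> is used on both sides, so the values at \<open>M\<close>
  agree. The divergences at \<open>M\<close> are affine in \<open>e\<close> with slopes of opposite
  sign, since \<open>M\<close> lies strictly between \<open>A\<close> and \<open>C\<close>; hence
  one \<open>e\<close> makes them agree as well.\<close>

lemma edge_lift:
  fixes A M C n a c :: "real^2"
  assumes g: "hpoly k gL" "hpoly k gR" "k > 0"
    and AC: "cross2 A C > 0" and M: "M = (1 - \<theta>) *\<^sub>R A + \<theta> *\<^sub>R C" and \<theta>: "0 < \<theta>" "\<theta> < 1"
    and n: "n \<bullet> A = -1" "n \<bullet> C = -1" and eq: "gL M = gR M" and ac: "n \<bullet> a = gL A" "n \<bullet> c = gR C"
  obtains wL wR where "hpoly_vec k wL" "hpoly_vec k wR"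
    "\<And>y. n \<bullet> wL y = gL y" "\<And>y. n \<bullet> wR y = gR y"
    "wL A = a" "wR C = c" "wL M = wR M" "divergence wL M = divergence wR M"
proof -
  let ?t = "C - A"
  have nt: "n \<bullet> ?t = 0" "n \<bullet> M = -1"
    using n by (simp_all add: M inner_simps)
  have cr: "cross2 A M = \<theta> * cross2 A C" "cross2 C M = - (1 - \<theta>) * cross2 A C"
    "cross2 A ?t = cross2 A C" "cross2 C ?t = cross2 A C"
    by (simp_all add: M cross2_simps cross2_commute[of A C] algebra_simps)
  have nz: "cross2 A M \<noteq> 0" "cross2 C M \<noteq> 0" "cross2 A ?t \<noteq> 0" "cross2 C ?t \<noteq> 0"
    unfolding cr using AC \<theta> by auto
  obtain wL X where L: "\<And>e. hpoly_vec k (wL e)" "\<And>e y. n \<bullet> wL e y = gL y" "\<And>e. wL e A = a"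
    "\<And>e. wL e M = - gL M *\<^sub>R M + e *\<^sub>R ?t"
    "\<And>e. divergence (wL e) M = X + e * (of_nat k * cross2 A ?t / cross2 A M)"
    using half_lift[OF g(1,3) nz(1) nt ac(1) nz(3)] by blast
  obtain wR Y where R: "\<And>e. hpoly_vec k (wR e)" "\<And>e y. n \<bullet> wR e y = gR y" "\<And>e. wR e C = c"
    "\<And>e. wR e M = - gR M *\<^sub>R M + e *\<^sub>R ?t"
    "\<And>e. divergence (wR e) M = Y + e * (of_nat k * cross2 C ?t / cross2 C M)"
    using half_lift[OF g(2,3) nz(2) nt ac(2) nz(4)] by blast
  have quot: "of_nat k * cross2 A ?t / cross2 A M = real k / \<theta>"
    "of_nat k * cross2 C ?t / cross2 C M = - (real k / (1 - \<theta>))"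
    unfolding cr using AC \<theta> by (simp_all add: field_simps)
  have pos: "real k / \<theta> + real k / (1 - \<theta>) > 0"
    using g(3) \<theta> by (intro add_pos_pos divide_pos_pos) auto
  define e where "e = (Y - X) / (real k / \<theta> + real k / (1 - \<theta>))"
  have "e * (real k / \<theta> + real k / (1 - \<theta>)) = Y - X"
    using pos by (simp add: e_def)
  then have "X + e * (real k / \<theta>) = Y + e * - (real k / (1 - \<theta>))"
    by (simp add: distrib_left)
  then have "divergence (wL e) M = divergence (wR e) M"
    by (simp only: L(5) R(5) quot)
  with L R eq show thesis
    by (intro that[of "wL e" "wR e"]) auto
qed

section \<open>Explicit preimages of homogeneous parts\<close>

lemma divergence_sum:
  assumes "finite I" "\<And>k c. k \<in> I \<Longrightarrow> (\<lambda>y. v k y $ c) differentiable at x"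
  shows "divergence (\<lambda>x. \<Sum>k\<in>I. v k x) x = (\<Sum>k\<in>I. divergence (v k) x)"
  using assms by (simp add: divergence_def partial_deriv_sum sum.distrib)

lemma hpoly_divergence_radial:
  assumes "hpoly k f"
  shows "divergence (\<lambda>y. f y *\<^sub>R y) y = (real k + 2) * f y"
proof -
  have "divergence (\<lambda>y. y) y = 2"
    by (simp add: divergence_def)
  then show ?thesis
    using divergence_scaleR[OF hpoly_differentiable[OF assms], of "\<lambda>y. y" y] hpoly_euler[OF assms, of y]
    by (simp add: sum_2 algebra_simps)
qed

text \<open>The product rule gives the function once, and vanishing divergence turns the derivative
  of the other component into the term missing from Euler's identity, which gives it
  \<open>k\<close> more times.\<close>

lemma hpoly_potential:
  assumes f: "hpoly k f" and g: "hpoly k g"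
    and div: "partial_deriv 1 f y + partial_deriv 2 g y = 0"
  shows "partial_deriv 2 (\<lambda>y. (y $ 2 * f y - y $ 1 * g y) / (real k + 1)) y = f y"
    "partial_deriv 1 (\<lambda>y. (y $ 2 * f y - y $ 1 * g y) / (real k + 1)) y = - g y"
proof -
  have pd: "partial_deriv i (\<lambda>y. (y $ 2 * f y - y $ 1 * g y) / (real k + 1)) y =
      (partial_deriv i (\<lambda>y. y $ 2 * f y) y - partial_deriv i (\<lambda>y. y $ 1 * g y) y) / (real k + 1)" for i
  proof -
    have "(\<lambda>y. (y $ 2 * f y - y $ 1 * g y) / (real k + 1)) =
        (\<lambda>y. (1 / (real k + 1)) * (y $ 2 * f y + (-1) * (y $ 1 * g y)))"
      by (simp add: diff_divide_distrib)
    then show ?thesis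
      using f g by (simp only: partial_deriv_cmult partial_deriv_add differentiable_mult
          differentiable_add differentiable_const differentiable_nth hpoly_differentiable) simp
  qed
  have "partial_deriv 2 g y = - partial_deriv 1 f y" "partial_deriv 1 f y = - partial_deriv 2 g y"
    using div by simp_all
  note d = this
  have "partial_deriv 2 (\<lambda>y. y $ 2 * f y) y - partial_deriv 2 (\<lambda>y. y $ 1 * g y) y = (real k + 1) * f y"
    using f g hpoly_euler[OF f, of y] by (simp add: partial_deriv_mult d(1) algebra_simps)
  then show "partial_deriv 2 (\<lambda>y. (y $ 2 * f y - y $ 1 * g y) / (real k + 1)) y = f y"
    unfolding pd by simp
  have "partial_deriv 1 (\<lambda>y. y $ 2 * f y) y - partial_deriv 1 (\<lambda>y. y $ 1 * g y) y = (real k + 1) * - g y"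
    using f g hpoly_euler[OF g, of y] by (simp add: partial_deriv_mult d(2) algebra_simps)
  then show "partial_deriv 1 (\<lambda>y. (y $ 2 * f y - y $ 1 * g y) / (real k + 1)) y = - g y"
    unfolding pd by simp
qed

section \<open>Lipschitz functions and integrals of derivatives\<close>

lemma lipschitz_on_UNIV_closed_cover:
  fixes f :: "'a::real_normed_vector \<Rightarrow> 'b::metric_space"
  assumes "finite I" "\<And>i. i \<in> I \<Longrightarrow> closed (U i)" "\<And>i. i \<in> I \<Longrightarrow> C-lipschitz_on (U i) f"
    "0 \<le> C" "(\<Union>i\<in>I. U i) = UNIV"
  shows "C-lipschitz_on UNIV f"
proof (rule lipschitz_onI)
  fix x y :: 'a
  \<comment> \<open>On the segment from \<open>x\<close> to \<open>y\<close> the problem is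
    one-dimensional: the pieces pull back to finitely many closed sets covering
    \<open>{0..1}\<close>, and the constant does not grow with the number of changes between
    them.\<close>
  define l where "l t = x + t *\<^sub>R (y - x)" for t :: real
  have l: "continuous_on UNIV l"
    unfolding l_def by (intro continuous_intros)
  have dist_l: "dist (l s) (l t) = \<bar>s - t\<bar> * dist x y" for s t
  proof -
    have "l s - l t = (s - t) *\<^sub>R (y - x)"
      by (simp add: l_def algebra_simps)
    then show ?thesis
      by (simp add: dist_norm norm_minus_commute)
  qed
  have "(C * dist x y)-lipschitz_on {0..1} (\<lambda>t. f (l t))"
  proof (rule lipschitz_on_closed_Union[where I = I and U = "\<lambda>i. l -` U i"])
    show "(C * dist x y)-lipschitz_on (l -` U i) (\<lambda>t. f (l t))" if "i \<in> I" for i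
    proof (rule lipschitz_onI)
      fix s t assume "s \<in> l -` U i" "t \<in> l -` U i"
      then have "dist (f (l s)) (f (l t)) \<le> C * dist (l s) (l t)"
        using lipschitz_onD[OF assms(3)[OF that]] by simp
      then show "dist (f (l s)) (f (l t)) \<le> C * dist x y * dist s t"
        by (simp add: dist_l dist_real_def mult_ac)
    qed (use assms(4) in simp)
    show "closed (l -` U i)" if "i \<in> I" for i
      using assms(2)[OF that] l by (simp add: continuous_closed_vimage continuous_on_eq_continuous_at)
    show "{0..1} \<subseteq> (\<Union>i\<in>I. l -` U i)"
      using assms(5) by blast
  qed (use assms in auto)
  from lipschitz_onD[OF this, of 0 1] show "dist (f x) (f y) \<le> C * dist x y"
    by (simp add: l_def)
qed (fact assms(4))

lemma has_integral_translate_UNIV: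
  fixes f :: "'a::euclidean_space \<Rightarrow> real"
  assumes "(f has_integral I) UNIV" "\<And>x. x \<notin> cbox a b \<Longrightarrow> f x = 0"
  shows "((\<lambda>x. f (x + c)) has_integral I) UNIV"
proof -
  have "(f has_integral I) (cbox a b)"
  proof -
    have "(\<lambda>x. if x \<in> cbox a b then f x else 0) = f"
      using assms(2) by auto
    then show ?thesis
      using assms(1) has_integral_restrict_UNIV[of "cbox a b" f I] by simp
  qed
  from has_integral_affinity'[OF this, of 1 c]
  have "((\<lambda>x. f (x + c)) has_integral I) (cbox (a - c) (b - c))"
    by simp
  moreover have "f (x + c) = 0" if "x \<notin> cbox (a - c) (b - c)" for x
    using that by (intro assms(2)) (auto simp: mem_box inner_simps algebra_simps)
  ultimately show ?thesis
    by (rule has_integral_on_superset) auto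
qed

text \<open>The integrals of the difference quotients vanish by translation invariance; the Lipschitz
  bound lets them pass to the limit.\<close>

lemma has_integral_directional_derivative_zero:
  fixes f g :: "'a::euclidean_space \<Rightarrow> real"
  assumes lip: "C-lipschitz_on UNIV f" and supp: "\<And>x. x \<notin> cbox a b \<Longrightarrow> f x = 0"
    and N: "negligible N" and e: "norm e = 1"
    and der: "\<And>x. x \<notin> N \<Longrightarrow> ((\<lambda>t. f (x + t *\<^sub>R e)) has_real_derivative g x) (at 0)"
  shows "(g has_integral 0) UNIV"
proof -
  define d where "d n = inverse (real (Suc n))" for n
  have d: "0 < d n" "d n \<le> 1" for n
    by (simp_all add: d_def inverse_le_1_iff)
  \<comment> \<open>On the null set \<open>N\<close> the quotients are replaced by 0, so that they
    converge everywhere.\<close>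
  define F where "F n x = (if x \<in> N then 0 else (f (x + d n *\<^sub>R e) - f x) / d n)" for n x
  have "f integrable_on cbox a b"
    using lipschitz_on_continuous_on[OF lip] by (intro integrable_continuous) (rule continuous_on_subset, auto)
  then have "f integrable_on UNIV"
    using supp by (rule integrable_on_superset) auto
  then obtain I where I: "(f has_integral I) UNIV"
    by blast
  have F: "(F n has_integral 0) UNIV" for n
  proof (rule has_integral_spike[OF N])
    have "((\<lambda>x. f (x + d n *\<^sub>R e) - f x) has_integral (I - I)) UNIV"
      by (intro has_integral_diff has_integral_translate_UNIV[OF I supp] I)
    from has_integral_divide[OF this, of "d n"]
    show "((\<lambda>x. (f (x + d n *\<^sub>R e) - f x) / d n) has_integral 0) UNIV"
      by simp
  qed (simp add: F_def)
  \<comment> \<open>The box grows by \<open>One\<close> on each side because the shifts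
    \<open>d n\<close> are at most 1; outside it both \<open>x\<close> and the shifted point miss
    \<open>cbox a b\<close>.\<close>
  define h where "h x = (if x \<in> cbox (a - One) (b + One) then C else 0)" for x :: 'a
  have h: "h integrable_on UNIV"
    unfolding h_def using integrable_const[of C "a - One" "b + One"]
    by (simp add: integrable_restrict_UNIV)
  have C: "0 \<le> C"
    using lip lipschitz_on_nonneg by blast
  have bound: "norm (F n x) \<le> h x" for n x
  proof (cases "x \<in> cbox (a - One) (b + One)")
    case True
    have "dist (f (x + d n *\<^sub>R e)) (f x) \<le> C * dist (x + d n *\<^sub>R e) x"
      by (rule lipschitz_onD[OF lip]) auto
    also have "dist (x + d n *\<^sub>R e) x = d n"
      using d[of n] e by (simp add: dist_norm)
    finally have "\<bar>f (x + d n *\<^sub>R e) - f x\<bar> \<le> C * d n"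
      by (simp add: dist_real_def)
    then show ?thesis
      using d[of n] C True by (simp add: F_def h_def pos_divide_le_eq)
  next
    case False
    then obtain i where i: "i \<in> Basis" "x \<bullet> i < a \<bullet> i - 1 \<or> x \<bullet> i > b \<bullet> i + 1"
      by (auto simp: mem_box inner_simps not_le)
    have "\<bar>(d n *\<^sub>R e) \<bullet> i\<bar> \<le> 1"
      using Basis_le_norm[OF i(1), of "d n *\<^sub>R e"] d[of n] e by simp
    then have "x + d n *\<^sub>R e \<notin> cbox a b" "x \<notin> cbox a b"
      using i by (auto simp: mem_box inner_simps intro!: bexI[of _ i])
    then show ?thesis
      using False supp by (simp add: F_def h_def)
  qed
  define G where "G x = (if x \<in> N then 0 else g x)" for x
  have lim: "(\<lambda>n. F n x) \<longlonglongrightarrow> G x" for x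
  proof (cases "x \<in> N")
    case False
    have "d \<longlonglongrightarrow> 0"
      unfolding d_def by (rule LIMSEQ_inverse_real_of_nat)
    moreover have "\<forall>\<^sub>F n in sequentially. d n \<noteq> 0"
      using d(1) by (simp add: less_imp_neq[symmetric])
    ultimately have "filterlim d (at 0) sequentially"
      by (simp add: filterlim_at)
    moreover have "((\<lambda>t. (f (x + t *\<^sub>R e) - f x) / t) \<longlongrightarrow> g x) (at 0)"
      using der[OF False] by (simp add: has_field_derivative_iff)
    ultimately have "(\<lambda>n. (f (x + d n *\<^sub>R e) - f x) / d n) \<longlonglongrightarrow> g x"
      by (rule filterlim_compose[rotated])
    then show ?thesis
      using False by (simp add: F_def G_def)
  qed (simp add: F_def G_def)
  have int: "F n integrable_on UNIV" "integral UNIV (F n) = 0" for n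
    using has_integral_integrable[OF F] integral_unique[OF F] by blast+
  have "G integrable_on UNIV"
    by (rule dominated_convergence(1)[OF int(1) h bound lim])
  moreover have "(\<lambda>n. integral UNIV (F n)) \<longlonglongrightarrow> integral UNIV G"
    by (rule dominated_convergence(2)[OF int(1) h bound lim])
  then have "integral UNIV G = 0"
    by (simp add: int(2) LIMSEQ_const_iff)
  ultimately have "(G has_integral 0) UNIV"
    by (metis integrable_integral)
  then show ?thesis
    by (rule has_integral_spike[OF N, rotated]) (simp add: G_def)
qed

lemma bivariate_poly_lipschitz:
  assumes f: "f \<in> bivariate_poly r" and X: "compact X" "convex X"
  obtains C where "C-lipschitz_on X f"
proof -
  have bdd: "\<exists>B. \<forall>x\<in>X. \<bar>partial_deriv c f x\<bar> \<le> B" for c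
  proof -
    have "bounded (partial_deriv c f ` X)"
      by (intro compact_imp_bounded compact_continuous_image X
          bivariate_poly_continuous[OF bivariate_poly_partial_deriv[OF f]])
    then show ?thesis
      unfolding bounded_iff by auto
  qed
  then obtain B where B: "\<And>c x. x \<in> X \<Longrightarrow> \<bar>partial_deriv c f x\<bar> \<le> B c"
    by metis
  let ?C = "\<bar>B 1\<bar> + \<bar>B 2\<bar>"
  have "?C-lipschitz_on X f"
  proof (rule bounded_derivative_imp_lipschitz[where
        f' = "\<lambda>x h. h $ 1 * partial_deriv 1 f x + h $ 2 * partial_deriv 2 f x"])
    show "(f has_derivative (\<lambda>h. h $ 1 * partial_deriv 1 f x + h $ 2 * partial_deriv 2 f x)) (at x within X)"
      for x
      using differentiable_partials[OF bivariate_poly_differentiable[OF f]] has_derivative_at_withinI by blast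
    show "onorm (\<lambda>h::real^2. h $ 1 * partial_deriv 1 f x + h $ 2 * partial_deriv 2 f x) \<le> ?C" if x: "x \<in> X" for x
    proof (rule onorm_bound)
      fix h :: "real^2"
      have "\<bar>h $ c * partial_deriv c f x\<bar> \<le> \<bar>B c\<bar> * norm h" for c
      proof -
        have "\<bar>h $ c\<bar> * \<bar>partial_deriv c f x\<bar> \<le> norm h * \<bar>B c\<bar>"
          using B[OF x, of c] by (intro mult_mono component_le_norm_cart) auto
        then show ?thesis
          by (simp add: abs_mult mult.commute)
      qed
      from this[of 1] this[of 2]
      show "norm (h $ 1 * partial_deriv 1 f x + h $ 2 * partial_deriv 2 f x) \<le> ?C * norm h"
        unfolding real_norm_def distrib_right by linarith
    qed simp
  qed (use X in auto)
  then show thesis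
    by (rule that)
qed

lemma directional_derivative_axis:
  fixes f :: "real^2 \<Rightarrow> real"
  assumes "f differentiable at x"
  shows "((\<lambda>t. f (x + t *\<^sub>R axis c 1)) has_real_derivative partial_deriv c f x) (at 0)"
proof -
  let ?D = "frechet_derivative f (at x)"
  have D: "(f has_derivative ?D) (at (x + 0 *\<^sub>R axis c 1))"
    using differentiable_has_derivative[OF assms] by simp
  have "((\<lambda>t. x + t *\<^sub>R axis c 1) has_derivative (\<lambda>t. t *\<^sub>R axis c 1)) (at 0)"
    by (auto intro!: derivative_eq_intros)
  from has_derivative_compose[OF this D]
  have "((\<lambda>t. f (x + t *\<^sub>R axis c 1)) has_derivative (\<lambda>t. ?D (t *\<^sub>R axis c 1))) (at 0)" .
  moreover have "?D (t *\<^sub>R axis c 1) = partial_deriv c f x * t" for t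
    using linear_scale[OF has_derivative_linear[OF differentiable_has_derivative[OF assms]]]
    by (simp add: partial_deriv_def)
  ultimately show ?thesis
    by (simp add: has_field_derivative_def)
qed

section \<open>Lifting along a fan of sectors\<close>

lemma UNIV_index: "(UNIV :: 3 set) = {0, 1, 2}"
proof -
  have "(3::3) = 0" by simp
  then show ?thesis unfolding UNIV_3 by auto
qed

lemma index_simps: "(0::3) + 1 = 1" "(1::3) + 1 = 2" "(2::3) + 1 = 0" "(0::3) + 2 = 2" "(1::3) + 2 = 0" "(2::3) + 2 = 1"
  by simp_all

lemma index_add: "(i::3) + 1 + 1 = i + 2" "i + 2 + 1 = i" "i + 1 + 2 = i" "i + 2 + 2 = i + 1"
  by simp_all

text \<open>The centre is moved to 0. The \<open>A i\<close> are the vertices in counter-clockwise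
  order, with cyclic indices because \<open>3 = 0\<close> in the type \<open>3\<close>, and
  \<open>M i\<close> splits the edge from \<open>A i\<close> to \<open>A (i + 1)\<close>. The vector
  \<open>n i\<close> is the gradient of the hat function on the large sector \<open>i\<close>:
  \<open>1 + n i \<bullet> y\<close> is 1 at the centre and 0 on that edge.\<close>

locale ps_fan =
  fixes A M n :: "3 \<Rightarrow> real^2" and \<theta> :: "3 \<Rightarrow> real"
  assumes cross_pos: "cross2 (A i) (A (i + 1)) > 0"
    and M_eq: "M i = (1 - \<theta> i) *\<^sub>R A i + \<theta> i *\<^sub>R A (i + 1)"
    and \<theta>: "0 < \<theta> i" "\<theta> i < 1"
    and n_start: "n i \<bullet> A i = -1"
    and n_end: "n i \<bullet> A (i + 1) = -1"
begin

lemma cross_pos': "cross2 (A (i + 1)) (A (i + 2)) > 0" "cross2 (A (i + 2)) (A i) > 0"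
  using cross_pos[of "i + 1"] cross_pos[of "i + 2"] unfolding index_add .

text \<open>Up to a common factor these are the barycentric coordinates of the centre: each
  coefficient is twice the area of the triangle spanned by the centre and the opposite edge.\<close>

lemma A_dependent:
  "cross2 (A (i + 1)) (A (i + 2)) *\<^sub>R A i + cross2 (A (i + 2)) (A i) *\<^sub>R A (i + 1) +
    cross2 (A i) (A (i + 1)) *\<^sub>R A (i + 2) = 0"
  using cross2_expand[of "A i" "A (i + 1)" "A (i + 2)"]
  by (simp add: cross2_commute[of "A (i + 2)" "A (i + 1)"] cross2_commute[of "A (i + 2)" "A i"])

text \<open>In the product of \<open>n i\<close> with the positive dependence of the vertices two
  terms are negative, so the third is positive.\<close>

lemma n_opposite: "n i \<bullet> A (i + 2) > 0"
proof -
  have "n i \<bullet> (cross2 (A (i + 1)) (A (i + 2)) *\<^sub>R A i + cross2 (A (i + 2)) (A i) *\<^sub>R A (i + 1) +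
    cross2 (A i) (A (i + 1)) *\<^sub>R A (i + 2)) = 0"
    by (simp add: A_dependent)
  then have "cross2 (A i) (A (i + 1)) * (n i \<bullet> A (i + 2)) =
      cross2 (A (i + 1)) (A (i + 2)) + cross2 (A (i + 2)) (A i)"
    by (simp add: inner_simps n_start n_end)
  then have "cross2 (A i) (A (i + 1)) * (n i \<bullet> A (i + 2)) > 0"
    using cross_pos'[of i] by simp
  then show ?thesis
    using cross_pos[of i] by (simp add: zero_less_mult_iff)
qed

lemma n_M: "n i \<bullet> M i = -1"
  by (simp add: M_eq inner_simps n_start n_end)

definition \<mu> :: "3 \<Rightarrow> real^2 \<Rightarrow> real" where
  "\<mu> i y = 1 + n i \<bullet> y"

text \<open>Follows from the Binet-Cauchy identity and \<open>n_opposite\<close>. This independence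
  of neighbouring gradients determines a lifted field on the rays towards the vertices.\<close>

lemma cross_n: "cross2 (n i) (n (i + 1)) \<noteq> 0"
proof -
  have "cross2 (n i) (n (i + 1)) * cross2 (A (i + 1)) (A (i + 2)) = 1 + n i \<bullet> A (i + 2)"
    using n_end[of i] n_start[of "i + 1"] n_end[of "i + 1"]
    unfolding index_add by (simp add: cross2_mult_inner)
  then show ?thesis
    using n_opposite[of i] by auto
qed

text \<open>Sector \<open>(i, False)\<close> lies between the rays through \<open>A i\<close> and \<open>M i\<close>, sector \<open>(i, True)\<close>
  between those through \<open>M i\<close> and \<open>A (i + 1)\<close>.\<close>

definition fan_continuous :: "(3 \<Rightarrow> bool \<Rightarrow> real^2 \<Rightarrow> 'a) \<Rightarrow> bool" where
  "fan_continuous F \<longleftrightarrow> (\<forall>i. \<forall>s\<in>{0..1}. F i False (s *\<^sub>R M i) = F i True (s *\<^sub>R M i) \<and>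
     F i True (s *\<^sub>R A (i + 1)) = F (i + 1) False (s *\<^sub>R A (i + 1)))"

text \<open>On the ray through \<open>A i\<close> the conditions from both sides form a regular
  linear system for the value of \<open>w\<close>, so \<open>g\<close> may jump there. The rays
  through \<open>M i\<close> are the subject of \<open>edge_lift\<close>.\<close>

lemma fan_lift:
  assumes g: "\<And>i b. hpoly k (g i b)" "k > 0" and mid: "\<And>i. g i False (M i) = g i True (M i)"
  obtains w where "\<And>i b. hpoly_vec k (w i b)" "\<And>i b y. n i \<bullet> w i b y = g i b y"
    "fan_continuous w" "\<And>i. divergence (w i False) (M i) = divergence (w i True) (M i)"
proof -
  \<comment> \<open>\<open>i + 2\<close> is the predecessor of \<open>i\<close>: these are the
    conditions of the two large sectors that meet along the ray through \<open>A i\<close>.\<close>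
  have "\<exists>a. n i \<bullet> a = g i False (A i) \<and> n (i + 2) \<bullet> a = g (i + 2) True (A i)" for i
  proof -
    have "cross2 (n (i + 2)) (n i) \<noteq> 0"
      using cross_n[of "i + 2"] unfolding index_add .
    then show ?thesis
      using cross2_solve by metis
  qed
  then obtain a where a: "\<And>i. n i \<bullet> a i = g i False (A i)" "\<And>i. n (i + 2) \<bullet> a i = g (i + 2) True (A i)"
    by metis
  have a': "n i \<bullet> a (i + 1) = g i True (A (i + 1))" for i
    using a(2)[of "i + 1"] unfolding index_add .
  have "\<exists>wL wR. hpoly_vec k wL \<and> hpoly_vec k wR \<and>
    (\<forall>y. n i \<bullet> wL y = g i False y) \<and> (\<forall>y. n i \<bullet> wR y = g i True y) \<and>
    wL (A i) = a i \<and> wR (A (i + 1)) = a (i + 1) \<and> wL (M i) = wR (M i) \<and>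
    divergence wL (M i) = divergence wR (M i)" for i
    using edge_lift[OF g(1)[of i False] g(1)[of i True] g(2) cross_pos[of i] M_eq[of i] \<theta>[of i]
        n_start n_end mid a(1) a'] by metis
  then obtain wL wR where w: "\<And>i. hpoly_vec k (wL i)" "\<And>i. hpoly_vec k (wR i)"
    "\<And>i y. n i \<bullet> wL i y = g i False y" "\<And>i y. n i \<bullet> wR i y = g i True y"
    "\<And>i. wL i (A i) = a i" "\<And>i. wR i (A (i + 1)) = a (i + 1)" "\<And>i. wL i (M i) = wR i (M i)"
    "\<And>i. divergence (wL i) (M i) = divergence (wR i) (M i)"
    by metis
  show thesis
  proof (rule that[of "\<lambda>i b. if b then wR i else wL i"])
    show "fan_continuous (\<lambda>i b. if b then wR i else wL i)"
      unfolding fan_continuous_def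
      by (simp add: w(5-7) hpoly_vec_scaleR[OF w(1)] hpoly_vec_scaleR[OF w(2)])
  qed (use w in auto)
qed

text \<open>Solvability of the divergence equation up to a one-dimensional defect. The defect has a
  fixed shape, of degree \<open>r\<close> in the large sector 0, so that the defects of several
  right-hand sides can be added. \<open>V\<close> is required to vanish on the whole line through
  the outer edge, which is a condition on the polynomial pieces alone.\<close>

definition solvable :: "nat \<Rightarrow> (3 \<Rightarrow> bool \<Rightarrow> real^2 \<Rightarrow> real) \<Rightarrow> bool" where
  "solvable r P \<longleftrightarrow> (\<exists>V \<delta>. (\<forall>i b c. (\<lambda>y. V i b y $ c) \<in> bivariate_poly (Suc r)) \<and> fan_continuous V \<and>
     (\<forall>i b y. \<mu> i y = 0 \<longrightarrow> V i b y = 0) \<and>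
     (\<forall>i b y. divergence (V i b) y = P i b y - (if i = 0 then \<delta> * \<mu> i y ^ r else 0)))"

lemma solvableI:
  assumes "\<And>i b c. (\<lambda>y. V i b y $ c) \<in> bivariate_poly (Suc r)" "fan_continuous V"
    "\<And>i b y. \<mu> i y = 0 \<Longrightarrow> V i b y = 0"
    "\<And>i b y. divergence (V i b) y = P i b y - (if i = 0 then \<delta> * \<mu> i y ^ r else 0)"
  shows "solvable r P"
  unfolding solvable_def by (intro exI[of _ V] exI[of _ \<delta>] conjI allI impI assms)

lemma solvableE:
  assumes "solvable r P"
  obtains V \<delta> where "\<And>i b c. (\<lambda>y. V i b y $ c) \<in> bivariate_poly (Suc r)" "fan_continuous V"
    "\<And>i b y. \<mu> i y = 0 \<Longrightarrow> V i b y = 0"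
    "\<And>i b y. divergence (V i b) y = P i b y - (if i = 0 then \<delta> * \<mu> i y ^ r else 0)"
  using assms unfolding solvable_def by (elim exE conjE) (rule that; blast)

lemma solvable_add:
  assumes "solvable r P" "solvable r Q"
  shows "solvable r (\<lambda>i b y. P i b y + Q i b y)"
proof -
  obtain V \<delta> where V: "\<And>i b c. (\<lambda>y. V i b y $ c) \<in> bivariate_poly (Suc r)" "fan_continuous V"
     "\<And>i b y. \<mu> i y = 0 \<Longrightarrow> V i b y = 0"
     "\<And>i b y. divergence (V i b) y = P i b y - (if i = 0 then \<delta> * \<mu> i y ^ r else 0)"
    using assms(1) by (rule solvableE) (rule that)
  obtain W \<epsilon> where W: "\<And>i b c. (\<lambda>y. W i b y $ c) \<in> bivariate_poly (Suc r)" "fan_continuous W"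
     "\<And>i b y. \<mu> i y = 0 \<Longrightarrow> W i b y = 0"
     "\<And>i b y. divergence (W i b) y = Q i b y - (if i = 0 then \<epsilon> * \<mu> i y ^ r else 0)"
    using assms(2) by (rule solvableE) (rule that)
  show ?thesis
  proof (rule solvableI[of "\<lambda>i b y. V i b y + W i b y" _ _ "\<delta> + \<epsilon>"])
    show "(\<lambda>y. (V i b y + W i b y) $ c) \<in> bivariate_poly (Suc r)" for i b c
      using bivariate_poly_add[OF V(1) W(1)] by simp
    show "fan_continuous (\<lambda>i b y. V i b y + W i b y)"
      using V(2) W(2) by (simp add: fan_continuous_def)
    show "divergence (\<lambda>y. V i b y + W i b y) y =
        P i b y + Q i b y - (if i = 0 then (\<delta> + \<epsilon>) * \<mu> i y ^ r else 0)" for i b y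
      by (subst divergence_add[OF bivariate_poly_differentiable[OF V(1)] bivariate_poly_differentiable[OF W(1)]])
        (simp add: V(4) W(4) distrib_right)
  qed (simp_all add: V(3) W(3))
qed

lemma solvable_sum:
  assumes "finite I" "I \<noteq> {}" "\<And>k. k \<in> I \<Longrightarrow> solvable r (P k)"
  shows "solvable r (\<lambda>i b y. \<Sum>k\<in>I. P k i b y)"
  using assms by (induction I rule: finite_ne_induct) (simp_all add: solvable_add)

lemma fan_continuous_\<mu>_scaleR:
  assumes "fan_continuous w"
  shows "fan_continuous (\<lambda>i b y. \<mu> i y ^ m *\<^sub>R w i b y)"
proof -
  have "\<mu> i (s *\<^sub>R A (i + 1)) = \<mu> (i + 1) (s *\<^sub>R A (i + 1))" for i s
    by (simp add: \<mu>_def n_end n_start)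
  then show ?thesis
    using assms by (simp add: fan_continuous_def)
qed

lemma bivariate_poly_\<mu>_scaleR:
  assumes "\<And>c. (\<lambda>y. w y $ c) \<in> bivariate_poly k"
  shows "(\<lambda>y. (\<mu> i y ^ m *\<^sub>R w y) $ (c::2)) \<in> bivariate_poly (m + k)"
  using bivariate_poly_affine_power_mult[OF assms, where a = 1 and u = "n i" and m = m] by (simp add: \<mu>_def)

lemma divergence_\<mu>_scaleR:
  assumes "\<And>c. (\<lambda>y. w y $ c) differentiable at x"
  shows "divergence (\<lambda>y. \<mu> i y ^ Suc m *\<^sub>R w y) x =
    \<mu> i x ^ Suc m * divergence w x + real (Suc m) * \<mu> i x ^ m * (n i \<bullet> w x)"
  unfolding \<mu>_def using divergence_affine_power_scaleR[OF assms, of 1 "n i" "Suc m"] by simp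

text \<open>A step trades one degree of \<open>g\<close> for one factor \<open>\<mu> i\<close>, so
  \<open>m\<close> varies in the induction while \<open>m + k\<close> stays fixed. The hypothesis
  concerns the rays through \<open>M i\<close> only, because \<open>divergence w\<close> may jump
  across the others.\<close>

lemma solvable_bernstein:
  assumes "\<And>i b. hpoly k (g i b)" "\<And>i. g i False (M i) = g i True (M i)"
  shows "solvable (m + k) (\<lambda>i b y. \<mu> i y ^ m * g i b y)"
  using assms
proof (induction k arbitrary: m g)
  case 0
  \<comment> \<open>Degree 0 means constant, and agreement at \<open>M i\<close> merges the two
    halves: one constant remains per large sector.\<close>
  have const: "g i b y = g i False 0" for i b y
  proof -
    have "g i b 0 = g i b x" for b x
      using hpoly_scaleR[OF 0(1), of i b 0 x] by simp
    then show ?thesis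
      using 0(2)[of i] by (metis (full_types))
  qed
  \<comment> \<open>Three constants face the two components of \<open>w\<close>: sectors 1 and 2 are
    matched exactly, and \<open>\<delta>\<close> records what is missing in sector 0.\<close>
  have "cross2 (n 1) (n 2) \<noteq> 0"
    using cross_n[of 1] by simp
  then obtain w where w: "n 1 \<bullet> w = g 1 False 0 / real (Suc m)" "n 2 \<bullet> w = g 2 False 0 / real (Suc m)"
    using cross2_solve by metis
  define \<delta> where "\<delta> = g 0 False 0 - real (Suc m) * (n 0 \<bullet> w)"
  show ?case
  proof (rule solvableI[of "\<lambda>i b y. \<mu> i y ^ Suc m *\<^sub>R w" _ _ \<delta>])
    show "(\<lambda>y. (\<mu> i y ^ Suc m *\<^sub>R w) $ c) \<in> bivariate_poly (Suc (m + 0))" for i c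
      using bivariate_poly_\<mu>_scaleR[of "\<lambda>_. w" 0 i "Suc m" c] by (simp add: bivariate_poly_const)
    show "fan_continuous (\<lambda>i b y. \<mu> i y ^ Suc m *\<^sub>R w)"
      by (rule fan_continuous_\<mu>_scaleR) (simp add: fan_continuous_def)
    show "divergence (\<lambda>y. \<mu> i y ^ Suc m *\<^sub>R w) y =
        \<mu> i y ^ m * g i b y - (if i = 0 then \<delta> * \<mu> i y ^ (m + 0) else 0)" for i b y
    proof -
      have "divergence (\<lambda>y. \<mu> i y ^ Suc m *\<^sub>R w) y = real (Suc m) * \<mu> i y ^ m * (n i \<bullet> w)"
        by (subst divergence_\<mu>_scaleR) (simp_all add: divergence_def)
      also have "\<dots> = \<mu> i y ^ m * g i False 0 - (if i = 0 then \<delta> * \<mu> i y ^ m else 0)"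
      proof -
        have "(3::3) = 0"
          by simp
        then have "i = 1 \<or> i = 2 \<or> i = 0"
          using exhaust_3[of i] by metis
        moreover have "real (Suc m) * \<mu> 0 y ^ m * (n 0 \<bullet> w) = \<mu> 0 y ^ m * g 0 False 0 - \<delta> * \<mu> 0 y ^ m"
          unfolding \<delta>_def by (simp only: algebra_simps)
        ultimately show ?thesis
          using w by (elim disjE) (simp_all del: of_nat_Suc)
      qed
      finally show ?thesis
        by (simp add: const[of i b y])
    qed
  qed simp
next
  case (Suc k)
  have "hpoly (Suc k) (\<lambda>y. g i b y / real (Suc m))" for i b
    using hpoly_cmult[OF Suc.prems(1), of "1 / real (Suc m)"] by simp
  then obtain w where w: "\<And>i b. hpoly_vec (Suc k) (w i b)" "\<And>i b y. n i \<bullet> w i b y = g i b y / real (Suc m)"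
    "fan_continuous w" "\<And>i. divergence (w i False) (M i) = divergence (w i True) (M i)"
    using fan_lift[of "Suc k" "\<lambda>i b y. g i b y / real (Suc m)"] Suc.prems(2)
    by (metis (no_types, lifting) zero_less_Suc)
  \<comment> \<open>The remainder of the product rule has the same form with \<open>Suc m\<close>
    and degree \<open>k\<close>; its agreement at \<open>M i\<close> is the one built into
    \<open>w\<close>.\<close>
  have "solvable (Suc m + k) (\<lambda>i b y. \<mu> i y ^ Suc m * (-1 * divergence (w i b) y))"
    using w(4) by (intro Suc.IH hpoly_cmult hpoly_divergence w(1)) simp
  moreover have "solvable (Suc m + k) (\<lambda>i b y. \<mu> i y ^ Suc m * divergence (w i b) y + \<mu> i y ^ m * g i b y)"
  proof (rule solvableI[of "\<lambda>i b y. \<mu> i y ^ Suc m *\<^sub>R w i b y" _ _ 0])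
    show "(\<lambda>y. (\<mu> i y ^ Suc m *\<^sub>R w i b y) $ c) \<in> bivariate_poly (Suc (Suc m + k))" for i b c
      using bivariate_poly_\<mu>_scaleR[OF hpoly_bivariate[OF hpoly_vec_nth[OF w(1)] order_refl], where i = i and m = "Suc m"]
      by simp
    show "fan_continuous (\<lambda>i b y. \<mu> i y ^ Suc m *\<^sub>R w i b y)"
      by (rule fan_continuous_\<mu>_scaleR) (rule w(3))
    show "divergence (\<lambda>y. \<mu> i y ^ Suc m *\<^sub>R w i b y) y = \<mu> i y ^ Suc m * divergence (w i b) y +
        \<mu> i y ^ m * g i b y - (if i = 0 then 0 * \<mu> i y ^ (Suc m + k) else 0)" for i b y
      by (subst divergence_\<mu>_scaleR[OF hpoly_vec_differentiable[OF w(1)]])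
        (simp add: w(2) del: of_nat_Suc)
  qed simp
  ultimately have "solvable (Suc m + k) (\<lambda>i b y. \<mu> i y ^ Suc m * (-1 * divergence (w i b) y) +
      (\<mu> i y ^ Suc m * divergence (w i b) y + \<mu> i y ^ m * g i b y))"
    by (rule solvable_add)
  then show ?case
    by (simp add: algebra_simps)
qed

text \<open>Degrees are raised by writing \<open>1\<close> as \<open>\<mu> i y + (- n i) \<bullet> y\<close>.\<close>

lemma solvable_raise:
  assumes "\<And>i b. hpoly k (g i b)" "\<And>i. g i False (M i) = g i True (M i)"
  shows "solvable (l + m + k) (\<lambda>i b y. \<mu> i y ^ m * g i b y)"
  using assms
proof (induction l arbitrary: m k g)
  case 0
  then show ?case using solvable_bernstein by simp
next
  case (Suc l)
  have 1: "solvable (l + Suc m + k) (\<lambda>i b y. \<mu> i y ^ Suc m * g i b y)"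
    by (rule Suc.IH) (rule Suc.prems)+
  \<comment> \<open>Agreement at \<open>M i\<close> survives the new factor, since both halves of a
    large sector share \<open>n i\<close>.\<close>
  have 2: "solvable (l + m + Suc k) (\<lambda>i b y. \<mu> i y ^ m * ((- n i \<bullet> y) * g i b y))"
  proof (rule Suc.IH)
    show "hpoly (Suc k) (\<lambda>y. (- n i \<bullet> y) * g i b y)" for i b
      using hpoly_mult[OF hpoly_inner Suc.prems(1), of "- n i" i b] by simp
  qed (simp add: Suc.prems)
  have deg: "l + Suc m + k = Suc l + m + k" "l + m + Suc k = Suc l + m + k"
    by simp_all
  have "solvable (Suc l + m + k) (\<lambda>i b y. \<mu> i y ^ Suc m * g i b y +
      \<mu> i y ^ m * ((- n i \<bullet> y) * g i b y))"
    using solvable_add[OF 1[unfolded deg] 2[unfolded deg]] .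
  moreover have "\<mu> i y ^ Suc m * g i b y + \<mu> i y ^ m * ((- n i \<bullet> y) * g i b y) = \<mu> i y ^ m * g i b y"
    for i b y
  proof -
    have "\<mu> i y ^ Suc m * g i b y + \<mu> i y ^ m * ((- n i \<bullet> y) * g i b y) =
        \<mu> i y ^ m * g i b y * (\<mu> i y - n i \<bullet> y)"
      by (simp add: algebra_simps)
    then show ?thesis
      by (simp add: \<mu>_def)
  qed
  ultimately show ?case
    by (simp only:)
qed

section \<open>Geometry of the six sectors\<close>

definition start_ray :: "3 \<Rightarrow> bool \<Rightarrow> real^2" where
  "start_ray i b = (if b then M i else A i)"

definition end_ray :: "3 \<Rightarrow> bool \<Rightarrow> real^2" where
  "end_ray i b = (if b then A (i + 1) else M i)"

lemma cross_M: "cross2 (A i) (M i) > 0" "cross2 (M i) (A (i + 1)) > 0"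
  using cross_pos[of i] \<theta>[of i]
  by (simp_all add: M_eq cross2_simps)

lemma cross_rays: "cross2 (start_ray i b) (end_ray i b) > 0"
  using cross_M by (simp add: start_ray_def end_ray_def)

lemma n_rays: "n i \<bullet> start_ray i b = -1" "n i \<bullet> end_ray i b = -1"
  by (simp_all add: start_ray_def end_ray_def n_start n_end n_M)

definition in_sector :: "3 \<Rightarrow> bool \<Rightarrow> real^2 \<Rightarrow> bool" where
  "in_sector i b y \<longleftrightarrow>
    (\<exists>\<alpha> \<beta>. 0 \<le> \<alpha> \<and> 0 \<le> \<beta> \<and> \<alpha> + \<beta> \<le> 1 \<and> y = \<alpha> *\<^sub>R start_ray i b + \<beta> *\<^sub>R end_ray i b)"

lemma in_sectorE:
  assumes "in_sector i b y"
  obtains \<alpha> \<beta> where "0 \<le> \<alpha>" "0 \<le> \<beta>" "\<alpha> + \<beta> \<le> 1" "y = \<alpha> *\<^sub>R start_ray i b + \<beta> *\<^sub>R end_ray i b"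
  using assms unfolding in_sector_def by blast

lemma in_sector_macro:
  assumes "in_sector i b y"
  obtains \<alpha> \<beta> where "0 \<le> \<alpha>" "0 \<le> \<beta>" "\<alpha> + \<beta> \<le> 1" "y = \<alpha> *\<^sub>R A i + \<beta> *\<^sub>R A (i + 1)"
proof -
  obtain \<alpha> \<beta> where *: "0 \<le> \<alpha>" "0 \<le> \<beta>" "\<alpha> + \<beta> \<le> 1" "y = \<alpha> *\<^sub>R start_ray i b + \<beta> *\<^sub>R end_ray i b"
    using assms by (rule in_sectorE)
  show thesis
  proof (cases b)
    case True
    with * \<theta>[of i] mult_left_le[of "\<theta> i" \<alpha>] show thesis
      by (intro that[of "\<alpha> * (1 - \<theta> i)" "\<alpha> * \<theta> i + \<beta>"])
        (auto simp: start_ray_def end_ray_def M_eq algebra_simps)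
  next
    case False
    with * \<theta>[of i] mult_left_le[of "\<theta> i" \<beta>] show thesis
      by (intro that[of "\<alpha> + \<beta> * (1 - \<theta> i)" "\<beta> * \<theta> i"])
        (auto simp: start_ray_def end_ray_def M_eq algebra_simps)
  qed
qed

lemma in_sector_cross:
  assumes "in_sector i b y"
  shows "cross2 (start_ray i b) y \<ge> 0" "cross2 (end_ray i b) y \<le> 0"
proof -
  obtain \<alpha> \<beta> where "0 \<le> \<alpha>" "0 \<le> \<beta>" "\<alpha> + \<beta> \<le> 1" "y = \<alpha> *\<^sub>R start_ray i b + \<beta> *\<^sub>R end_ray i b"
    using assms by (rule in_sectorE)
  then show "cross2 (start_ray i b) y \<ge> 0" "cross2 (end_ray i b) y \<le> 0"
    using cross_rays[of i b]
    by (simp_all add: cross2_simps cross2_commute[of "end_ray i b" "start_ray i b"])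
qed

lemma in_sector_both_halves:
  assumes "in_sector i False y" "in_sector i True y"
  obtains s where "s \<in> {0..1}" "y = s *\<^sub>R M i"
proof -
  obtain \<alpha> \<beta> where *: "0 \<le> \<alpha>" "0 \<le> \<beta>" "\<alpha> + \<beta> \<le> 1" "y = \<alpha> *\<^sub>R A i + \<beta> *\<^sub>R M i"
    using in_sectorE[OF assms(1)] by (auto simp: start_ray_def end_ray_def)
  have "cross2 (M i) y \<ge> 0"
    using in_sector_cross(1)[OF assms(2)] by (simp add: start_ray_def)
  then have "\<alpha> * cross2 (A i) (M i) \<le> 0"
    by (simp add: * cross2_simps cross2_commute[of "M i" "A i"])
  then have "\<alpha> = 0"
    using *(1) cross_M(1)[of i] by (simp add: mult_le_0_iff)
  with * show thesis
    by (intro that[of \<beta>]) auto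
qed

text \<open>The halves that do not touch the common ray meet it in the centre only; this is what the
  alternatives with \<open>s = 0\<close> record.\<close>

lemma in_sector_neighbours:
  assumes "in_sector i b y" "in_sector (i + 1) b' y"
  obtains s where "s \<in> {0..1}" "y = s *\<^sub>R A (i + 1)" "b \<or> s = 0" "\<not> b' \<or> s = 0"
proof -
  obtain \<alpha> \<beta> where *: "0 \<le> \<alpha>" "0 \<le> \<beta>" "\<alpha> + \<beta> \<le> 1" "y = \<alpha> *\<^sub>R A i + \<beta> *\<^sub>R A (i + 1)"
    using assms(1) by (rule in_sector_macro)
  obtain \<gamma> \<delta> where **: "0 \<le> \<gamma>" "0 \<le> \<delta>" "y = \<gamma> *\<^sub>R A (i + 1) + \<delta> *\<^sub>R A (i + 2)"
    using assms(2) by (rule in_sector_macro) (simp only: index_add)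
  \<comment> \<open>Sector \<open>i + 1\<close> lies to the left of the ray through
    \<open>A (i + 1)\<close> and sector \<open>i\<close> to its right, so \<open>y\<close> lies on
    it.\<close>
  have "cross2 (A (i + 1)) y \<ge> 0"
    using **(2) cross_pos'[of i] by (simp add: **(3) cross2_simps)
  then have "\<alpha> * cross2 (A i) (A (i + 1)) \<le> 0"
    by (simp add: *(4) cross2_simps cross2_commute[of "A (i + 1)" "A i"])
  then have "\<alpha> = 0"
    using *(1) cross_pos[of i] by (simp add: mult_le_0_iff)
  then have y: "y = \<beta> *\<^sub>R A (i + 1)"
    using * by simp
  have "b \<or> \<beta> = 0"
  proof (cases b)
    case False
    then have "\<beta> * cross2 (M i) (A (i + 1)) \<le> 0"
      using in_sector_cross(2)[OF assms(1)] by (simp add: end_ray_def y cross2_simps)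
    then show ?thesis
      using *(2) cross_M(2)[of i] by (simp add: mult_le_0_iff)
  qed simp
  moreover have "\<not> b' \<or> \<beta> = 0"
  proof (cases b')
    case True
    then have "\<beta> * cross2 (A (i + 1)) (M (i + 1)) \<le> 0"
      using in_sector_cross(1)[OF assms(2)]
      by (simp add: start_ray_def y cross2_simps cross2_commute[of "M (i + 1)" "A (i + 1)"])
    then show ?thesis
      using *(2) cross_M(1)[of "i + 1"] by (simp add: mult_le_0_iff)
  qed simp
  ultimately show thesis
    using * y \<open>\<alpha> = 0\<close> by (intro that[of \<beta>]) auto
qed

lemma fan_continuous_0:
  assumes "fan_continuous F"
  shows "F i b 0 = F j b' 0"
proof -
  have "F i False 0 = F i True 0" "F i True 0 = F (i + 1) False 0" for i
    using assms unfolding fan_continuous_def by (metis (no_types) atLeastAtMost_iff order_refl scale_zero_left zero_le_one)+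
  then have "F i b 0 = F i False 0" "F (i + 1) False 0 = F i False 0" for i b
    by (metis (full_types))+
  moreover have "j = i \<or> j = i + 1 \<or> j = i + 1 + 1"
    using exhaust_3[of i] exhaust_3[of j] by auto
  ultimately show ?thesis
    by metis
qed

lemma fan_continuous_neighbours:
  assumes "fan_continuous F" "in_sector i b y" "in_sector (i + 1) b' y"
  shows "F i b y = F (i + 1) b' y"
proof -
  obtain s where s: "s \<in> {0..1}" "y = s *\<^sub>R A (i + 1)" "b \<or> s = 0" "\<not> b' \<or> s = 0"
    using in_sector_neighbours[OF assms(2,3)] .
  show ?thesis
  proof (cases "s = 0")
    case True
    then show ?thesis
      using fan_continuous_0[OF assms(1)] s(2) by simp
  next
    case False
    then show ?thesis
      using assms(1) s by (simp add: fan_continuous_def)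
  qed
qed

text \<open>Any two of three cyclically ordered large sectors are equal or neighbours, so agreement
  on the six rays gives agreement on every overlap.\<close>

lemma fan_continuous_eq:
  assumes F: "fan_continuous F" and "in_sector i b y" "in_sector j b' y"
  shows "F i b y = F j b' y"
proof -
  have "j = i \<or> j = i + 1 \<or> i = j + 1"
    using exhaust_3[of i] exhaust_3[of j] by auto
  then consider "j = i" | "j = i + 1" | "i = j + 1"
    by blast
  then show ?thesis
  proof cases
    case 1
    have "F i False y = F i True y" if "in_sector i False y" "in_sector i True y"
      using in_sector_both_halves[OF that] F unfolding fan_continuous_def by metis
    then show ?thesis
      using assms 1 by (cases b; cases b') auto
  next
    case 2
    then show ?thesis
      using fan_continuous_neighbours[OF F] assms by simp
  next
    case 3
    then show ?thesis
      using fan_continuous_neighbours[OF F assms(3), of b] assms by simp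
  qed
qed

text \<open>Subtracting a multiple of the positive dependence of the \<open>A j\<close> kills the coefficient that
  is smallest relative to it.\<close>

lemma ex_macro_sector:
  assumes c: "\<And>j. c j \<ge> (0::real)"
  obtains i \<alpha> \<beta> where "\<alpha> \<ge> 0" "\<beta> \<ge> 0" "(\<Sum>j\<in>UNIV. c j *\<^sub>R A j) = \<alpha> *\<^sub>R A i + \<beta> *\<^sub>R A (i + 1)"
proof -
  define l where "l j = cross2 (A (j + 1)) (A (j + 2))" for j
  have l: "l j > 0" for j
    using cross_pos'[of j] by (simp add: l_def)
  have sum3: "(\<Sum>j\<in>UNIV. f j) = f i + f (i + 1) + f (i + 2)" for f :: "3 \<Rightarrow> real^2" and i
  proof -
    have "i \<in> {0, 1, 2}"
      using UNIV_index by blast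
    moreover have "(\<Sum>j\<in>UNIV. f j) = f 0 + f 1 + f 2"
      unfolding UNIV_index by (simp add: add.assoc)
    ultimately show ?thesis
      by (elim insertE emptyE) (simp_all only: index_simps, simp_all add: add_ac)
  qed
  obtain k where k: "\<And>j. c k / l k \<le> c j / l j"
    using ex_min_if_finite[of "range (\<lambda>j. c j / l j)"] by (auto simp: not_less)
  define \<tau> where "\<tau> = c k / l k"
  have "(\<Sum>j\<in>UNIV. l j *\<^sub>R A j) = 0"
    using A_dependent[of k] unfolding sum3[of _ k] l_def by (simp only: index_add)
  then have "(\<Sum>j\<in>UNIV. c j *\<^sub>R A j) = (\<Sum>j\<in>UNIV. (c j - \<tau> * l j) *\<^sub>R A j)"
    by (simp add: scaleR_left_diff_distrib sum_subtractf flip: scaleR_scaleR scaleR_sum_right)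
  also have "\<dots> = (c (k + 1) - \<tau> * l (k + 1)) *\<^sub>R A (k + 1) + (c (k + 2) - \<tau> * l (k + 2)) *\<^sub>R A (k + 2)"
    unfolding sum3[of _ k] using l[of k] by (simp add: \<tau>_def)
  finally have eq: "(\<Sum>j\<in>UNIV. c j *\<^sub>R A j) =
      (c (k + 1) - \<tau> * l (k + 1)) *\<^sub>R A (k + 1) + (c (k + 2) - \<tau> * l (k + 2)) *\<^sub>R A (k + 1 + 1)"
    by (simp only: index_add)
  have "c j - \<tau> * l j \<ge> 0" for j
    using k[of j] l[of j] by (simp add: \<tau>_def pos_le_divide_eq)
  then show thesis
    using eq by (intro that)
qed

lemma n_A_ge: "n i \<bullet> A j \<ge> -1"
proof -
  have "j = i \<or> j = i + 1 \<or> j = i + 2"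
    using exhaust_3[of i] exhaust_3[of j] by auto
  then show ?thesis
    using n_start[of i] n_end[of i] n_opposite[of i] by auto
qed

lemma ex_sector:
  assumes c: "\<And>j. c j \<ge> (0::real)" "(\<Sum>j\<in>UNIV. c j) = 1"
  obtains i b where "in_sector i b (\<Sum>j\<in>UNIV. c j *\<^sub>R A j)"
proof -
  obtain i \<alpha> \<beta> where *: "\<alpha> \<ge> 0" "\<beta> \<ge> 0" "(\<Sum>j\<in>UNIV. c j *\<^sub>R A j) = \<alpha> *\<^sub>R A i + \<beta> *\<^sub>R A (i + 1)"
    by (rule ex_macro_sector[of c, OF c(1)])
  \<comment> \<open>All vertices satisfy \<open>n i \<bullet> A j \<ge> -1\<close>; the same bound
    for their convex combination becomes \<open>\<alpha> + \<beta> \<le> 1\<close>.\<close>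
  have "(\<Sum>j\<in>UNIV. c j * (n i \<bullet> A j)) \<ge> (\<Sum>j\<in>UNIV. c j * -1)"
    by (intro sum_mono mult_left_mono n_A_ge c)
  also have "(\<Sum>j\<in>UNIV. c j * (n i \<bullet> A j)) = n i \<bullet> (\<Sum>j\<in>UNIV. c j *\<^sub>R A j)"
    by (simp add: inner_sum_right)
  also have "\<dots> = - \<alpha> - \<beta>"
    unfolding *(3) by (simp add: inner_simps n_start n_end)
  finally have le: "\<alpha> + \<beta> \<le> 1"
    using c(2) by (simp add: sum_negf)
  \<comment> \<open>The point lies on the ray through \<open>M i\<close> when \<open>s = t\<close>;
    comparing \<open>s\<close> with \<open>t\<close> decides which half contains it.\<close>
  define s where "s = \<beta> / \<theta> i"
  define t where "t = \<alpha> / (1 - \<theta> i)"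
  have st: "s * \<theta> i = \<beta>" "t * (1 - \<theta> i) = \<alpha>" "s \<ge> 0" "t \<ge> 0"
    using \<theta>[of i] * by (simp_all add: s_def t_def)
  show thesis
  proof (cases "s \<le> t")
    case True
    have "in_sector i False (\<alpha> *\<^sub>R A i + \<beta> *\<^sub>R A (i + 1))"
      unfolding in_sector_def start_ray_def end_ray_def
    proof (rule exI[of _ "\<alpha> - s * (1 - \<theta> i)"], rule exI[of _ s], intro conjI)
      show "0 \<le> \<alpha> - s * (1 - \<theta> i)"
        using mult_right_mono[OF True, of "1 - \<theta> i"] \<theta>[of i] st by simp
      show "\<alpha> - s * (1 - \<theta> i) + s \<le> 1"
        using le st(1) by (simp add: algebra_simps)
      show "\<alpha> *\<^sub>R A i + \<beta> *\<^sub>R A (i + 1) =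
          (\<alpha> - s * (1 - \<theta> i)) *\<^sub>R (if False then M i else A i) + s *\<^sub>R (if False then A (i + 1) else M i)"
        by (simp add: M_eq algebra_simps flip: st(1))
    qed (fact st)
    then show thesis
      using that *(3) by metis
  next
    case False
    have "in_sector i True (\<alpha> *\<^sub>R A i + \<beta> *\<^sub>R A (i + 1))"
      unfolding in_sector_def start_ray_def end_ray_def
    proof (rule exI[of _ t], rule exI[of _ "\<beta> - t * \<theta> i"], intro conjI)
      show "0 \<le> \<beta> - t * \<theta> i"
        using mult_right_mono[of t s "\<theta> i"] False \<theta>[of i] st by simp
      show "t + (\<beta> - t * \<theta> i) \<le> 1"
        using le st(2) by (simp add: algebra_simps)
      show "\<alpha> *\<^sub>R A i + \<beta> *\<^sub>R A (i + 1) =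
          t *\<^sub>R (if True then M i else A i) + (\<beta> - t * \<theta> i) *\<^sub>R (if True then A (i + 1) else M i)"
        by (simp add: M_eq algebra_simps flip: st(2))
    qed (fact st)
    then show thesis
      using that *(3) by metis
  qed
qed

end

section \<open>The Powell--Sabin split\<close>

text \<open>\<open>z 3\<close> gets index 0, in accordance with \<open>3 = 0\<close>. Then
  \<open>M 0\<close>, \<open>M 1\<close>, \<open>M 2\<close> split the edges that start at
  \<open>z 3\<close>, \<open>z 1\<close>, \<open>z 2\<close>, hence the order \<open>z 5\<close>,
  \<open>z 6\<close>, \<open>z 4\<close>.\<close>

locale ps_triangulation = ps_fan +
  fixes z :: "nat \<Rightarrow> real^2"
  assumes A_eq: "A 0 = z 3 - z 0" "A 1 = z 1 - z 0" "A 2 = z 2 - z 0"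
    and M_z: "M 0 = z 5 - z 0" "M 1 = z 6 - z 0" "M 2 = z 4 - z 0"
    and z_interior: "z 0 \<in> interior (ps_triangle z)"
begin

section \<open>The six triangles and the boundary\<close>

definition tri :: "3 \<Rightarrow> bool \<Rightarrow> (real^2) set" where
  "tri i b = convex hull {z 0, z 0 + start_ray i b, z 0 + end_ray i b}"

lemma ps_split_eq: "ps_split z = (\<Union>i. \<Union>b. {tri i b})"
  unfolding ps_split_def tri_def start_ray_def end_ray_def UNIV_index UNIV_bool
  by (simp only: UN_insert UN_empty index_simps if_True if_False A_eq M_z)
    (simp add: insert_commute)

lemma tri_in_split: "tri i b \<in> ps_split z"
  unfolding ps_split_eq by blast

lemma ps_splitE:
  assumes "S \<in> ps_split z"
  obtains i b where "S = tri i b"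
  using assms unfolding ps_split_eq by blast

lemma tri_iff: "x \<in> tri i b \<longleftrightarrow> in_sector i b (x - z 0)"
  unfolding tri_def convex_hull_3_alt in_sector_def
  by (auto simp: algebra_simps)

lemma ps_triangle_hull: "ps_triangle z = convex hull ((\<lambda>i. z 0 + A i) ` UNIV)"
  unfolding ps_triangle_def UNIV_index by (simp add: A_eq insert_commute)

lemma convex_triangle: "convex (ps_triangle z)"
  by (simp add: ps_triangle_def)

lemma compact_triangle: "compact (ps_triangle z)"
  unfolding ps_triangle_def by (intro compact_convex_hull finite_imp_compact) auto

lemma closed_triangle: "closed (ps_triangle z)"
  using compact_triangle by (rule compact_imp_closed)

lemma compact_tri: "compact (tri i b)"
  unfolding tri_def by (intro compact_convex_hull finite_imp_compact) auto

lemma closed_tri: "closed (tri i b)"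
  using compact_tri by (rule compact_imp_closed)

lemma A_in_triangle: "z 0 + A i \<in> ps_triangle z"
  unfolding ps_triangle_hull by (intro hull_inc) auto

lemma M_in_triangle: "z 0 + M i \<in> ps_triangle z"
proof -
  have "(1 - \<theta> i) *\<^sub>R (z 0 + A i) + \<theta> i *\<^sub>R (z 0 + A (i + 1)) \<in> ps_triangle z"
    using \<theta>[of i] convex_triangle A_in_triangle by (intro convexD) auto
  then show ?thesis
    by (simp add: M_eq algebra_simps)
qed

lemma tri_subset: "tri i b \<subseteq> ps_triangle z"
  unfolding tri_def
proof (rule hull_minimal)
  show "{z 0, z 0 + start_ray i b, z 0 + end_ray i b} \<subseteq> ps_triangle z"
    using z_interior interior_subset A_in_triangle M_in_triangle
    by (auto simp: start_ray_def end_ray_def)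
qed (rule convex_triangle)

lemma triangle_cover:
  assumes "x \<in> ps_triangle z"
  obtains i b where "x \<in> tri i b"
proof -
  obtain c where c: "\<And>j. c j \<ge> (0::real)" "(\<Sum>j\<in>UNIV. c j) = 1" "x = (\<Sum>j\<in>UNIV. c j *\<^sub>R (z 0 + A j))"
  proof -
    have "x \<in> convex hull {z 0 + A 1, z 0 + A 2, z 0 + A 3}"
      using assms unfolding ps_triangle_hull UNIV_3 by simp
    then obtain u v w where "0 \<le> u" "0 \<le> v" "0 \<le> w" "u + v + w = 1"
      "x = u *\<^sub>R (z 0 + A 1) + v *\<^sub>R (z 0 + A 2) + w *\<^sub>R (z 0 + A 3)"
      unfolding convex_hull_3 by blast
    then show thesis
      using exhaust_3
      by (intro that[of "\<lambda>j. if j = 1 then u else if j = 2 then v else w"]) (auto simp: sum_3)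
  qed
  have "x - z 0 = (\<Sum>j\<in>UNIV. c j *\<^sub>R A j)"
    using c(2) by (simp add: c(3) scaleR_right_distrib sum.distrib flip: scaleR_sum_left)
  then show thesis
    using ex_sector[OF c(1,2)] that unfolding tri_iff by metis
qed

lemma triangle_eq: "ps_triangle z = (\<Union>p\<in>UNIV. tri (fst p) (snd p))"
proof (intro equalityI subsetI)
  fix x assume "x \<in> ps_triangle z"
  then obtain i b where "x \<in> tri i b"
    by (rule triangle_cover)
  then show "x \<in> (\<Union>p\<in>UNIV. tri (fst p) (snd p))"
    by (intro UN_I[of "(i, b)"]) simp_all
qed (use tri_subset in blast)

lemma interior_tri_nonempty: "interior (tri i b) \<noteq> {}"
proof -
  have "\<not> collinear {start_ray i b, 0, end_ray i b}"
  proof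
    assume "collinear {start_ray i b, 0, end_ray i b}"
    then have "collinear {0, start_ray i b, end_ray i b}"
      by (simp add: insert_commute)
    then have "cross2 (start_ray i b) (end_ray i b) = 0"
      unfolding collinear_lemma by (auto simp: cross2_simps)
    then show False
      using cross_rays[of i b] by simp
  qed
  then have "\<not> collinear {z 0, z 0 + start_ray i b, z 0 + end_ray i b}"
    using collinear_3[of "z 0 + start_ray i b" "z 0" "z 0 + end_ray i b"]
      by (simp add: insert_commute)
  then have "interior (tri i b) = {v. \<exists>x y w. 0 < x \<and> 0 < y \<and> 0 < w \<and> x + y + w = 1 \<and>
      x *\<^sub>R z 0 + y *\<^sub>R (z 0 + start_ray i b) + w *\<^sub>R (z 0 + end_ray i b) = v}"
    unfolding tri_def by (rule interior_convex_hull_3_minimal) simp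
  moreover have "0 < (1/3::real) \<and> (1/3::real) + 1/3 + 1/3 = 1"
    by simp
  ultimately show ?thesis
    by blast
qed

text \<open>Lets identities known on the interiors, where piecewise polynomials are compared, pass
  to the closed triangles by continuity.\<close>

lemma closure_interior_tri: "closure (interior (tri i b)) = tri i b"
  using convex_closure_interior[OF _ interior_tri_nonempty, of i b] closed_tri[of i b]
  by (simp add: tri_def closure_closed)

lemma \<mu>_nonneg:
  assumes "in_sector i b y"
  shows "\<mu> i y \<ge> 0"
proof -
  obtain \<alpha> \<beta> where "0 \<le> \<alpha>" "0 \<le> \<beta>" "\<alpha> + \<beta> \<le> 1" "y = \<alpha> *\<^sub>R start_ray i b + \<beta> *\<^sub>R end_ray i b"
    using assms by (rule in_sectorE)
  then show ?thesis
    by (simp add: \<mu>_def inner_simps n_rays)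
qed

text \<open>If \<open>\<mu>\<close> were positive, \<open>x\<close> would be \<open>z 0\<close> or
  lie strictly between the interior point \<open>z 0\<close> and another point of the triangle,
  hence be interior by convexity.\<close>

lemma frontier_imp_\<mu>:
  assumes "x \<in> frontier (ps_triangle z)" "x \<in> tri i b"
  shows "\<mu> i (x - z 0) = 0"
proof (rule ccontr)
  assume "\<mu> i (x - z 0) \<noteq> 0"
  with assms(2) have pos: "\<mu> i (x - z 0) > 0"
    using \<mu>_nonneg tri_iff by fastforce
  obtain \<alpha> \<beta> where *: "0 \<le> \<alpha>" "0 \<le> \<beta>" "x - z 0 = \<alpha> *\<^sub>R start_ray i b + \<beta> *\<^sub>R end_ray i b"
    using assms(2) unfolding tri_iff by (rule in_sectorE)
  have \<mu>: "\<mu> i (x - z 0) = 1 - (\<alpha> + \<beta>)"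
    by (simp add: * \<mu>_def inner_simps n_rays)
  have "x \<in> interior (ps_triangle z)"
  proof (cases "\<alpha> + \<beta> = 0")
    case True
    then have "\<alpha> = 0" "\<beta> = 0"
      using * by linarith+
    then have "x = z 0"
      using *(3) by simp
    then show ?thesis using z_interior by simp
  next
    case False
    \<comment> \<open>Dividing by \<open>s\<close> pushes the point along its ray out to the outer
      edge.\<close>
    define s where "s = \<alpha> + \<beta>"
    have s: "0 < s" "s < 1"
      using False * pos[unfolded \<mu>] by (simp_all add: s_def)
    let ?w = "(1 / s) *\<^sub>R (x - z 0)"
    have "in_sector i b ?w"
      unfolding in_sector_def
    proof (rule exI[of _ "\<alpha> / s"], rule exI[of _ "\<beta> / s"], intro conjI)
      have "\<alpha> / s + \<beta> / s = s / s"
        by (simp only: s_def add_divide_distrib)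
      then show "\<alpha> / s + \<beta> / s \<le> 1"
        using s by simp
    qed (use * s in \<open>simp_all add: scaleR_right_distrib\<close>)
    then have "z 0 + ?w \<in> ps_triangle z"
      using tri_iff[of "z 0 + ?w" i b] tri_subset by auto
    then have "z 0 + ?w - (1 - s) *\<^sub>R (z 0 + ?w - z 0) \<in> interior (ps_triangle z)"
      using s z_interior convex_triangle by (intro mem_interior_convex_shrink) auto
    moreover have "z 0 + u - (1 - s) *\<^sub>R (z 0 + u - z 0) = z 0 + s *\<^sub>R u" for u
      by (simp add: algebra_simps)
    moreover have "z 0 + s *\<^sub>R ?w = x"
      using s by simp
    ultimately show ?thesis
      by metis
  qed
  then show False
    using assms(1) by (simp add: frontier_def)
qed

text \<open>The line through the outer edge supports the triangle, because no vertex lies beyond it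
  (\<open>n_A_ge\<close>).\<close>

lemma \<mu>_imp_frontier:
  assumes "x \<in> tri i b" "\<mu> i (x - z 0) = 0"
  shows "x \<in> frontier (ps_triangle z)"
proof -
  let ?H = "{x. n i \<bullet> x \<ge> n i \<bullet> z 0 - 1}"
  have "ps_triangle z \<subseteq> ?H"
    unfolding ps_triangle_hull
  proof (rule hull_minimal)
    show "(\<lambda>i. z 0 + A i) ` UNIV \<subseteq> ?H"
    proof (intro image_subsetI CollectI)
      fix j show "n i \<bullet> z 0 - 1 \<le> n i \<bullet> (z 0 + A j)"
        using n_A_ge[of i j] by (simp add: inner_right_distrib)
    qed
  qed (rule convex_halfspace_ge)
  then have "interior (ps_triangle z) \<subseteq> interior ?H"
    by (rule interior_mono)
  also have "\<dots> = {x. n i \<bullet> x > n i \<bullet> z 0 - 1}"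
    using n_start[of i] by (intro interior_halfspace_ge) auto
  finally have "x \<notin> interior (ps_triangle z)"
    using assms(2) by (auto simp: \<mu>_def inner_simps)
  moreover have "x \<in> ps_triangle z"
    using assms(1) tri_subset by auto
  ultimately show ?thesis
    using closed_triangle by (simp add: frontier_def)
qed

section \<open>Gluing the six pieces\<close>

definition glue :: "(3 \<Rightarrow> bool \<Rightarrow> real^2 \<Rightarrow> 'a::zero) \<Rightarrow> real^2 \<Rightarrow> 'a" where
  "glue F x = (if x \<in> ps_triangle z
     then let p = SOME p. x \<in> tri (fst p) (snd p) in F (fst p) (snd p) (x - z 0) else 0)"

lemma glue_eq:
  assumes "fan_continuous F" "x \<in> tri i b"
  shows "glue F x = F i b (x - z 0)"
proof -
  let ?p = "SOME p. x \<in> tri (fst p) (snd p)"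
  have "x \<in> tri (fst ?p) (snd ?p)"
    by (rule someI[where x = "(i, b)"]) (simp add: assms)
  then have "F (fst ?p) (snd ?p) (x - z 0) = F i b (x - z 0)"
    using assms by (auto simp: tri_iff intro: fan_continuous_eq)
  moreover have "x \<in> ps_triangle z"
    using assms(2) tri_subset by auto
  ultimately show ?thesis
    by (simp add: glue_def Let_def)
qed

lemma glue_continuous:
  fixes F :: "3 \<Rightarrow> bool \<Rightarrow> real^2 \<Rightarrow> 'a::{zero,topological_space}"
  assumes "fan_continuous F" "\<And>i b. continuous_on UNIV (F i b)"
  shows "continuous_on (ps_triangle z) (glue F)"
  unfolding triangle_eq
proof (rule continuous_on_closed_Union)
  fix p :: "3 \<times> bool"
  have "continuous_on (tri (fst p) (snd p)) (\<lambda>x. F (fst p) (snd p) (x - z 0))"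
    by (rule continuous_on_compose2[OF assms(2)]) (auto intro: continuous_intros)
  then show "continuous_on (tri (fst p) (snd p)) (glue F)"
    by (rule continuous_on_eq) (simp add: glue_eq[OF assms(1)])
qed (auto simp: closed_tri)

lemma glue_L0:
  assumes "fan_continuous F" "\<And>i b. F i b \<in> bivariate_poly r"
  shows "glue F \<in> L0 z r"
  unfolding L0_def pw_poly_def
proof (intro CollectI conjI ballI)
  fix S assume "S \<in> ps_split z"
  then obtain i b where S: "S = tri i b"
    by (rule ps_splitE)
  show "\<exists>f\<in>bivariate_poly r. \<forall>x\<in>interior S. glue F x = f x"
    using glue_eq[OF assms(1), of _ i b] interior_subset[of S]
    by (intro bexI[OF _ bivariate_poly_translate[OF assms(2)[of i b], of "z 0"]]) (auto simp: S)
next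
  show "continuous_on (ps_triangle z) (glue F)"
    by (intro glue_continuous assms bivariate_poly_continuous[OF assms(2)])
qed

lemma glue_nth: "glue F x $ c = glue (\<lambda>i b y. F i b y $ c) x"
  by (simp add: glue_def Let_def)

lemma glue_L1:
  assumes "fan_continuous F" "\<And>i b c. (\<lambda>y. F i b y $ c) \<in> bivariate_poly r"
  shows "glue F \<in> L1 z r"
  unfolding L1_def mem_Collect_eq glue_nth
proof (intro allI glue_L0 assms)
  show "fan_continuous (\<lambda>i b y. F i b y $ c)" for c
    using assms(1) by (simp add: fan_continuous_def)
qed

text \<open>Along a ray shared by two pieces, \<open>p\<close> is a polynomial in the ray parameter,
  and its coefficients are the values of the homogeneous parts. Two such polynomials that agree on
  an interval agree in every coefficient.\<close>

lemma L0_decompose: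
  assumes "p \<in> L0 z r"
  obtains h where "\<And>k i b. hpoly k (h k i b)" "\<And>k. fan_continuous (h k)"
    "\<And>i b x. x \<in> tri i b \<Longrightarrow> p x = (\<Sum>k\<le>r. h k i b (x - z 0))"
proof -
  have "\<exists>h. (\<forall>k. hpoly k (h k)) \<and> (\<forall>x\<in>tri i b. p x = (\<Sum>k\<le>r. h k (x - z 0)))" for i b
  proof -
    obtain f where f: "f \<in> bivariate_poly r" "\<And>x. x \<in> interior (tri i b) \<Longrightarrow> p x = f x"
      using assms tri_in_split unfolding L0_def pw_poly_def by blast
    \<comment> \<open>The translation makes the parts homogeneous about \<open>z 0\<close> instead
      of the origin.\<close>
    obtain h where h: "\<And>k. hpoly k (h k)" "\<And>x. f (x - (- z 0)) = (\<Sum>k\<le>r. h k x)"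
      using bivariate_poly_decompose[OF bivariate_poly_translate[OF f(1), of "- z 0"]] by blast
    have "continuous_on (tri i b) (\<lambda>x. p x - f x)"
      using assms tri_subset unfolding L0_def
      by (auto intro!: continuous_on_diff bivariate_poly_continuous[OF f(1)] intro: continuous_on_subset)
    then have "p x - f x = 0" if "x \<in> tri i b" for x
      using continuous_constant_on_closure[of "interior (tri i b)" "\<lambda>x. p x - f x" 0 x] f(2) that
      unfolding closure_interior_tri by auto
    then show ?thesis
      using h(1) h(2)[of "_ - z 0"] by (intro exI[of _ h]) simp
  qed
  then obtain H where H: "\<And>i b k. hpoly k (H i b k)"
    "\<And>i b x. x \<in> tri i b \<Longrightarrow> p x = (\<Sum>k\<le>r. H i b k (x - z 0))"
    by metis
  \<comment> \<open>Nothing is known about parts beyond degree \<open>r\<close>; setting them to 0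
    makes the claims hold for all \<open>k\<close>.\<close>
  define h where "h k i b = (if k \<le> r then H i b k else (\<lambda>_. 0))" for k i b
  have ray: "H i b k y = H j b' k y"
    if "k \<le> r" "\<And>s. 0 < s \<Longrightarrow> s < 1 \<Longrightarrow> in_sector i b (s *\<^sub>R y)"
      "\<And>s. 0 < s \<Longrightarrow> s < 1 \<Longrightarrow> in_sector j b' (s *\<^sub>R y)" for i j b b' k y
  proof (rule power_sum_coeff_eq[where r = r])
    fix s :: real assume s: "0 < s" "s < 1"
    have "(\<Sum>k\<le>r. H i b k (s *\<^sub>R y)) = (\<Sum>k\<le>r. H j b' k (s *\<^sub>R y))"
      using H(2)[of "z 0 + s *\<^sub>R y" i b] H(2)[of "z 0 + s *\<^sub>R y" j b'] that(2,3)[OF s]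
      by (simp add: tri_iff)
    then show "(\<Sum>k\<le>r. H i b k y * s ^ k) = (\<Sum>k\<le>r. H j b' k y * s ^ k)"
      by (simp add: hpoly_scaleR[OF H(1)] mult.commute)
  qed (fact that(1))
  have start: "in_sector i b (s *\<^sub>R start_ray i b)" if "0 < s" "s < 1" for s i b
    unfolding in_sector_def by (rule exI[where x = s], rule exI[where x = 0]) (use that in simp)
  have ends: "in_sector i b (s *\<^sub>R end_ray i b)" if "0 < s" "s < 1" for s i b
    unfolding in_sector_def by (rule exI[where x = 0], rule exI[where x = s]) (use that in simp)
  have "H i False k (M i) = H i True k (M i)" "H i True k (A (i + 1)) = H (i + 1) False k (A (i + 1))"
    if "k \<le> r" for k i
    using ray[OF that, of i False "M i" i True] ray[OF that, of i True "A (i + 1)" "i + 1" False]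
      start[of _ i True] start[of _ "i + 1" False] ends[of _ i True] ends[of _ i False]
    by (auto simp: start_ray_def end_ray_def)
  then have "fan_continuous (h k)" for k
    unfolding fan_continuous_def h_def by (simp add: hpoly_scaleR[OF H(1)])
  moreover have "hpoly k (h k i b)" for k i b
    unfolding h_def using H(1) hpoly_zero by simp
  moreover have "p x = (\<Sum>k\<le>r. h k i b (x - z 0))" if "x \<in> tri i b" for x i b
    using H(2)[OF that] by (simp add: h_def)
  ultimately show thesis
    by (intro that)
qed

section \<open>Derivatives of glued functions and preimages without boundary values\<close>

lemma interior_tri_mem: "x \<in> interior (tri i b) \<Longrightarrow> x \<in> tri i b"
  using interior_subset by blast

lemma pw_eqI:
  assumes "\<And>i b x. x \<in> interior (tri i b) \<Longrightarrow> f x = g x"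
  shows "pw_eq z f g"
  unfolding pw_eq_def using assms by (auto elim!: ps_splitE)

lemma pw_eqD: "pw_eq z f g \<Longrightarrow> x \<in> interior (tri i b) \<Longrightarrow> f x = g x"
  unfolding pw_eq_def using tri_in_split by blast

lemma partial_deriv_glue:
  assumes "fan_continuous F" "F i b \<in> bivariate_poly r" "x \<in> interior (tri i b)"
  shows "partial_deriv c (glue F) x = partial_deriv c (F i b) (x - z 0)"
proof -
  have "partial_deriv c (glue F) x = partial_deriv c (\<lambda>x. F i b (x - z 0)) x"
    using assms(3) glue_eq[OF assms(1)] interior_subset
    by (intro partial_deriv_cong[OF open_interior]) blast+
  then show ?thesis
    using assms(2) by (simp add: partial_deriv_translate)
qed

lemma divergence_glue:
  assumes "fan_continuous V" "\<And>c. (\<lambda>y. V i b y $ c) \<in> bivariate_poly r" "x \<in> interior (tri i b)"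
  shows "divergence (glue V) x = divergence (V i b) (x - z 0)"
proof -
  have "fan_continuous (\<lambda>i b y. V i b y $ c)" for c
    using assms(1) by (simp add: fan_continuous_def)
  from partial_deriv_glue[OF this assms(2,3)] show ?thesis
    by (simp add: divergence_def glue_nth)
qed

lemma rot_glue:
  assumes "fan_continuous q" "q i b \<in> bivariate_poly r" "x \<in> interior (tri i b)"
  shows "rot (glue q) x = vector [partial_deriv 2 (q i b) (x - z 0), - partial_deriv 1 (q i b) (x - z 0)]"
  using assms by (simp add: rot_def partial_deriv_glue)

lemma S1I:
  assumes "v \<in> L1 z s" "p \<in> L0 z r" "pw_eq z (divergence v) p"
  shows "v \<in> S1 z s"
  using assms unfolding S1_def L0_def by blast

lemma ex_divergence_preimage:
  assumes "p \<in> L2 z r"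
  shows "\<exists>v\<in>S1 z (r + 1). pw_eq z (divergence v) p"
proof -
  have p: "p \<in> L0 z r"
    using assms by (simp add: L2_def)
  obtain h where h: "\<And>k i b. hpoly k (h k i b)" "\<And>k. fan_continuous (h k)"
    "\<And>i b x. x \<in> tri i b \<Longrightarrow> p x = (\<Sum>k\<le>r. h k i b (x - z 0))"
    by (rule L0_decompose[OF p]) (rule that)
  define W where "W k i b y = (h k i b y / (real k + 2)) *\<^sub>R y" for k i b y
  define V where "V i b y = (\<Sum>k\<le>r. W k i b y)" for i b y
  have hk: "hpoly k (\<lambda>y. h k i b y / (real k + 2))" for k i b
    using hpoly_cmult[OF h(1)[of k i b], where c = "1 / (real k + 2)"] by simp
  have W: "hpoly (Suc k) (\<lambda>y. W k i b y $ c)" for k i b c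
    using hpoly_nth_mult[OF hk] by (simp add: W_def mult.commute)
  have Wb: "(\<lambda>y. W k i b y $ c) \<in> bivariate_poly (r + 1)" if "k \<le> r" for k i b c
    using that by (intro hpoly_bivariate[OF W]) simp
  have V: "(\<lambda>y. V i b y $ c) \<in> bivariate_poly (r + 1)" for i b c
    unfolding V_def sum_component by (intro bivariate_poly_sum Wb) simp
  have cont: "fan_continuous V"
    using h(2) by (simp add: fan_continuous_def V_def W_def)
  have "divergence (V i b) y = (\<Sum>k\<le>r. h k i b y)" for i b y
  proof -
    have "divergence (V i b) y = (\<Sum>k\<le>r. divergence (W k i b) y)"
      unfolding V_def[abs_def] by (intro divergence_sum hpoly_differentiable[OF W]) simp
    also have "\<dots> = (\<Sum>k\<le>r. h k i b y)"
      unfolding W_def by (intro sum.cong) (simp_all add: hpoly_divergence_radial[OF hk])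
    finally show ?thesis .
  qed
  then have eq: "pw_eq z (divergence (glue V)) p"
    by (intro pw_eqI) (simp add: divergence_glue[OF cont V] h(3)[OF interior_tri_mem])
  then show ?thesis
    using glue_L1[OF cont V] S1I[OF _ p] by blast
qed

lemma continuous_on_L1:
  assumes "v \<in> L1 z r"
  shows "continuous_on (ps_triangle z) v"
proof -
  have "continuous_on (ps_triangle z) (\<lambda>x. \<chi> c. v x $ c)"
    using assms unfolding L1_def L0_def by (intro continuous_on_vec_lambda) blast
  then show ?thesis
    by simp
qed

text \<open>Applies \<open>hpoly_potential\<close> part by part. Every homogeneous part of
  \<open>v\<close> must be divergence-free for this, which follows by scaling towards the centre.
  The gradient is identified on the closed triangles so that it is available on the
  boundary.\<close>

lemma ex_potential:
  assumes v: "v \<in> L1 z r" and div: "pw_eq z (divergence v) (\<lambda>_. 0)"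
  obtains q where "\<And>i b. q i b \<in> bivariate_poly (r + 1)" "fan_continuous q"
    "\<And>i b x. x \<in> tri i b \<Longrightarrow> partial_deriv 2 (q i b) (x - z 0) = v x $ 1"
    "\<And>i b x. x \<in> tri i b \<Longrightarrow> partial_deriv 1 (q i b) (x - z 0) = - v x $ 2"
proof -
  have vc: "(\<lambda>x. v x $ c) \<in> L0 z r" for c
    using v by (simp add: L1_def)
  obtain f where f: "\<And>k i b. hpoly k (f k i b)" "\<And>k. fan_continuous (f k)"
    "\<And>i b x. x \<in> tri i b \<Longrightarrow> v x $ 1 = (\<Sum>k\<le>r. f k i b (x - z 0))"
    by (rule L0_decompose[OF vc[of 1]]) (rule that)
  obtain g where g: "\<And>k i b. hpoly k (g k i b)" "\<And>k. fan_continuous (g k)"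
    "\<And>i b x. x \<in> tri i b \<Longrightarrow> v x $ 2 = (\<Sum>k\<le>r. g k i b (x - z 0))"
    by (rule L0_decompose[OF vc[of 2]]) (rule that)
  define d where "d k i b y = partial_deriv 1 (f k i b) y + partial_deriv 2 (g k i b) y" for k i b y
  \<comment> \<open>The divergence has degree \<open>k - 1\<close>; the extra factor
    \<open>t\<close> on the left keeps the formula valid at \<open>k = 0\<close>, where
    \<open>d\<close> vanishes.\<close>
  have d_scale: "t * d k i b (t *\<^sub>R y) = t ^ k * d k i b y" for t k i b y
  proof (cases k)
    case 0
    then show ?thesis
      using f(1)[of 0] g(1)[of 0] by (simp add: d_def hpoly_0_partial_deriv)
  next
    case (Suc l)
    have "hpoly l (d k i b)"
      unfolding d_def[abs_def] using f(1)[of k] g(1)[of k] Suc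
      by (intro hpoly_add hpoly_partial_deriv) auto
    then show ?thesis
      using Suc by (simp add: hpoly_scaleR)
  qed
  have d_sum: "(\<Sum>k\<le>r. d k i b (x - z 0)) = 0" if x: "x \<in> interior (tri i b)" for i b x
  proof -
    have "partial_deriv c (\<lambda>x. v x $ c) x = (\<Sum>k\<le>r. partial_deriv c (F k i b) (x - z 0))"
      if F: "\<And>k i b. hpoly k (F k i b)"
        "\<And>i b x. x \<in> tri i b \<Longrightarrow> v x $ c = (\<Sum>k\<le>r. F k i b (x - z 0))" for c F
    proof -
      have "partial_deriv c (\<lambda>x. v x $ c) x = partial_deriv c (\<lambda>x. \<Sum>k\<le>r. F k i b (x - z 0)) x"
        using x F(2) interior_tri_mem by (intro partial_deriv_cong[OF open_interior]) blast+
      also have "\<dots> = partial_deriv c (\<lambda>y. \<Sum>k\<le>r. F k i b y) (x - z 0)"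
        by (intro partial_deriv_translate[of "\<lambda>y. \<Sum>k\<le>r. F k i b y"] differentiable_sum)
          (simp_all add: hpoly_differentiable[OF F(1)])
      also have "\<dots> = (\<Sum>k\<le>r. partial_deriv c (F k i b) (x - z 0))"
        by (intro partial_deriv_sum hpoly_differentiable[OF F(1)]) simp
      finally show ?thesis .
    qed
    from this[OF f(1,3)] this[OF g(1,3)] show ?thesis
      using pw_eqD[OF div x] by (simp add: divergence_def d_def sum.distrib)
  qed
  have d_zero: "d k i b (x - z 0) = 0" if x: "x \<in> interior (tri i b)" and k: "k \<le> r" for k i b x
  proof -
    have "(\<Sum>k\<le>r. d k i b (x - z 0) * t ^ k) = (\<Sum>k\<le>r. 0 * t ^ k)" if t: "0 < t" "t < 1" for t
    proof -
      have "z 0 \<in> tri i b"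
        unfolding tri_def by (intro hull_inc) simp
      \<comment> \<open>Points strictly between \<open>z 0\<close> and \<open>x\<close> are again
        interior, so the divergence vanishes along the segment and all its coefficients in
        \<open>t\<close> are 0.\<close>
      then have "z 0 - t *\<^sub>R (z 0 - x) \<in> interior (tri i b)"
        using x t by (intro mem_interior_convex_shrink) (auto simp: tri_def)
      from d_sum[OF this] have "(\<Sum>k\<le>r. d k i b (t *\<^sub>R (x - z 0))) = 0"
        by (simp add: algebra_simps)
      then have "(\<Sum>k\<le>r. t * d k i b (t *\<^sub>R (x - z 0))) = 0"
        by (simp flip: sum_distrib_left)
      then show ?thesis
        by (simp add: d_scale mult.commute)
    qed
    then show ?thesis
      using power_sum_coeff_eq[where c = "\<lambda>k. d k i b (x - z 0)" and d = "\<lambda>_. 0" and r = r and k = k] k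
      by simp
  qed
  define Q where "Q k i b y = (y $ 2 * f k i b y - y $ 1 * g k i b y) / (real k + 1)" for k i b y
  define q where "q i b y = (\<Sum>k\<le>r. Q k i b y)" for i b y
  have Q: "hpoly (Suc k) (Q k i b)" for k i b
  proof -
    have "hpoly (Suc k) (\<lambda>y. (1 / (real k + 1)) * (y $ 2 * f k i b y + (-1) * (y $ 1 * g k i b y)))"
      by (intro hpoly_cmult hpoly_add hpoly_nth_mult f(1) g(1))
    then show ?thesis
      by (simp add: Q_def[abs_def] diff_divide_distrib)
  qed
  have q: "q i b \<in> bivariate_poly (r + 1)" for i b
    unfolding q_def[abs_def] by (intro bivariate_poly_sum hpoly_bivariate[OF Q]) simp
  have pd: "partial_deriv c (q i b) y = (\<Sum>k\<le>r. partial_deriv c (Q k i b) y)" for c i b y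
    unfolding q_def[abs_def] by (intro partial_deriv_sum hpoly_differentiable[OF Q]) simp
  have cont: "fan_continuous q"
    using f(2) g(2) by (simp add: fan_continuous_def q_def Q_def)
  have closed_eq: "F (x - z 0) = w x" if F: "F \<in> bivariate_poly s" and w: "w \<in> L0 z r"
    and eq: "\<And>x. x \<in> interior (tri i b) \<Longrightarrow> F (x - z 0) = w x" and x: "x \<in> tri i b" for F s w i b x
  proof -
    have "continuous_on (tri i b) (\<lambda>x. F (x - z 0) - w x)"
      using w tri_subset unfolding L0_def
      by (auto intro!: continuous_on_diff bivariate_poly_continuous[OF bivariate_poly_translate[OF F]]
          intro: continuous_on_subset)
    then have "F (x - z 0) - w x = 0"
      using continuous_constant_on_closure[of "interior (tri i b)" "\<lambda>x. F (x - z 0) - w x" 0 x] eq x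
      unfolding closure_interior_tri by auto
    then show ?thesis
      by simp
  qed
  have "partial_deriv 2 (q i b) (x - z 0) = v x $ 1" if "x \<in> tri i b" for i b x
  proof (rule closed_eq[OF bivariate_poly_partial_deriv[OF q] vc _ that])
    fix x assume x: "x \<in> interior (tri i b)"
    have "partial_deriv 2 (Q k i b) (x - z 0) = f k i b (x - z 0)" if "k \<le> r" for k
      unfolding Q_def[abs_def] using d_zero[OF x that] unfolding d_def
      by (intro hpoly_potential f(1) g(1))
    then show "partial_deriv 2 (q i b) (x - z 0) = v x $ 1"
      by (simp add: pd f(3)[OF interior_tri_mem[OF x]])
  qed
  moreover have "partial_deriv 1 (q i b) (x - z 0) = - v x $ 2" if "x \<in> tri i b" for i b x
  proof -
    have "- 1 * partial_deriv 1 (q i b) (x - z 0) = v x $ 2"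
    proof (rule closed_eq[OF bivariate_poly_cmult[OF bivariate_poly_partial_deriv[OF q]] vc _ that])
      fix x assume x: "x \<in> interior (tri i b)"
      have "partial_deriv 1 (Q k i b) (x - z 0) = - g k i b (x - z 0)" if "k \<le> r" for k
        unfolding Q_def[abs_def] using d_zero[OF x that] unfolding d_def
        by (intro hpoly_potential f(1) g(1))
      then show "- 1 * partial_deriv 1 (q i b) (x - z 0) = v x $ 2"
        by (simp add: pd g(3)[OF interior_tri_mem[OF x]] sum_negf)
    qed
    then show ?thesis by simp
  qed
  ultimately show thesis
    using q cont by (intro that)
qed

lemma glue_potential:
  assumes v: "v \<in> L1 z r" and q: "\<And>i b. q i b \<in> bivariate_poly (r + 1)" "fan_continuous q"
    "\<And>i b x. x \<in> tri i b \<Longrightarrow> partial_deriv 2 (q i b) (x - z 0) = v x $ 1"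
    "\<And>i b x. x \<in> tri i b \<Longrightarrow> partial_deriv 1 (q i b) (x - z 0) = - v x $ 2"
  shows "pw_eq z (rot (glue q)) v" "glue q \<in> S0 z (r + 1)"
proof -
  show "pw_eq z (rot (glue q)) v"
    by (rule pw_eqI)
      (simp add: rot_glue[OF q(2,1)] q(3,4)[OF interior_tri_mem] vec_eq_iff forall_2)
  then show "glue q \<in> S0 z (r + 1)"
    unfolding S0_def using glue_L0[OF q(2,1)] continuous_on_L1[OF v] by blast
qed

lemma ex_rot_preimage:
  assumes "v \<in> L1 z r" "pw_eq z (divergence v) (\<lambda>_. 0)"
  shows "\<exists>q\<in>S0 z (r + 1). pw_eq z (rot q) v"
proof -
  obtain q where "\<And>i b. q i b \<in> bivariate_poly (r + 1)" "fan_continuous q"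
    "\<And>i b x. x \<in> tri i b \<Longrightarrow> partial_deriv 2 (q i b) (x - z 0) = v x $ 1"
    "\<And>i b x. x \<in> tri i b \<Longrightarrow> partial_deriv 1 (q i b) (x - z 0) = - v x $ 2"
    by (rule ex_potential[OF assms]) (rule that)
  from glue_potential[OF assms(1) this] show ?thesis
    by blast
qed

section \<open>Potentials with boundary values\<close>

lemma edge_parametrization:
  assumes "x \<in> tri i b" "\<mu> i (x - z 0) = 0"
  obtains s where "s \<in> {0..1}" "x - z 0 = start_ray i b + s *\<^sub>R (end_ray i b - start_ray i b)"
proof -
  obtain \<alpha> \<beta> where *: "0 \<le> \<alpha>" "0 \<le> \<beta>" "x - z 0 = \<alpha> *\<^sub>R start_ray i b + \<beta> *\<^sub>R end_ray i b"
    using assms(1) unfolding tri_iff by (rule in_sectorE)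
  have "\<alpha> = 1 - \<beta>"
    using assms(2) by (simp add: * \<mu>_def inner_simps n_rays)
  with * show thesis
    by (intro that[of \<beta>]) (auto simp: algebra_simps)
qed

lemma edge_in_tri:
  assumes "s \<in> {0..1}" "y = start_ray i b + s *\<^sub>R (end_ray i b - start_ray i b)"
  shows "z 0 + y \<in> tri i b" "\<mu> i y = 0"
proof -
  have "in_sector i b y"
    unfolding in_sector_def
    by (rule exI[of _ "1 - s"], rule exI[of _ s]) (use assms in \<open>auto simp: algebra_simps\<close>)
  then show "z 0 + y \<in> tri i b"
    by (simp add: tri_iff)
  show "\<mu> i y = 0"
    using assms(2) by (simp add: \<mu>_def inner_simps n_rays)
qed

text \<open>The whole gradient vanishes along the edge, hence so does the derivative of
  \<open>q\<close> along its parametrization.\<close>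

lemma potential_edge_const:
  assumes q: "q \<in> bivariate_poly r"
    "\<And>x. x \<in> tri i b \<Longrightarrow> \<mu> i (x - z 0) = 0 \<Longrightarrow> partial_deriv 1 q (x - z 0) = 0 \<and> partial_deriv 2 q (x - z 0) = 0"
    and x: "x \<in> tri i b" "\<mu> i (x - z 0) = 0"
  shows "q (x - z 0) = q (start_ray i b)"
proof -
  define l where "l s = start_ray i b + s *\<^sub>R (end_ray i b - start_ray i b)" for s :: real
  have "((\<lambda>s. q (l s)) has_field_derivative 0) (at s within {0..1})" if "s \<in> {0..1}" for s
  proof -
    have "partial_deriv 1 q (l s) = 0 \<and> partial_deriv 2 q (l s) = 0"
      using q(2)[of "z 0 + l s"] edge_in_tri[OF that, of "l s" i b] by (simp add: l_def)
    then have "(q has_derivative (\<lambda>h. 0)) (at (l s))"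
      using differentiable_partials[of q "l s"] q(1) by simp
    moreover have "(l has_derivative (\<lambda>h. h *\<^sub>R (end_ray i b - start_ray i b))) (at s within {0..1})"
      unfolding l_def by (auto intro!: derivative_eq_intros)
    ultimately have "((\<lambda>s. q (l s)) has_derivative (\<lambda>h. 0)) (at s within {0..1})"
      by (rule has_derivative_compose[rotated])
    then show ?thesis
      by (simp add: has_field_derivative_def lambda_zero)
  qed
  then obtain c where c: "\<And>s. s \<in> {0..1} \<Longrightarrow> q (l s) = c"
    using has_field_derivative_zero_constant[of "{0..1}" "\<lambda>s. q (l s)"] by auto
  obtain s where s: "s \<in> {0..1}" "x - z 0 = l s"
    using edge_parametrization[OF x] unfolding l_def by metis
  have "start_ray i b = l 0"
    by (simp add: l_def)
  then show ?thesis
    using c[of s] c[of 0] s by simp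
qed

lemma ex_rot_preimage_ring:
  assumes v: "v \<in> L1_ring z r" and div: "pw_eq z (divergence v) (\<lambda>_. 0)"
  shows "\<exists>q\<in>S0_ring z (r + 1). pw_eq z (rot q) v"
proof -
  have vL: "v \<in> L1 z r" and v0: "\<And>x. x \<in> frontier (ps_triangle z) \<Longrightarrow> v x = 0"
    using v by (auto simp: L1_ring_def)
  obtain q where q: "\<And>i b. q i b \<in> bivariate_poly (r + 1)" "fan_continuous q"
    "\<And>i b x. x \<in> tri i b \<Longrightarrow> partial_deriv 2 (q i b) (x - z 0) = v x $ 1"
    "\<And>i b x. x \<in> tri i b \<Longrightarrow> partial_deriv 1 (q i b) (x - z 0) = - v x $ 2"
    by (rule ex_potential[OF vL div]) (rule that)
  have const: "q i b (x - z 0) = q i b (start_ray i b)" if "x \<in> tri i b" "\<mu> i (x - z 0) = 0" for i b x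
    using q(3,4) v0[OF \<mu>_imp_frontier] by (intro potential_edge_const[OF q(1) _ that]) simp
  have ends: "q i b (end_ray i b) = q i b (start_ray i b)" for i b
    using edge_in_tri[of 1 "end_ray i b" i b] const[of "z 0 + end_ray i b" i b] by simp
  \<comment> \<open>Continuity at \<open>M i\<close> and \<open>A (i + 1)\<close> links the
    constants of consecutive half edges, so one constant serves the entire boundary.\<close>
  have ray: "q i False (M i) = q i True (M i)" "q i True (A (i + 1)) = q (i + 1) False (A (i + 1))" for i
    using q(2) unfolding fan_continuous_def by (metis atLeastAtMost_iff order_refl scaleR_one zero_le_one)+
  have M: "q i True (M i) = q i False (A i)" for i
    using ends[of i False] ray(1)[of i] by (simp add: start_ray_def end_ray_def)
  have "q (i + 1) False (A (i + 1)) = q i False (A i)" for i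
    using ends[of i True] ray(2)[of i] M[of i] by (simp add: start_ray_def end_ray_def)
  from this[of 0] this[of 1] have "q i False (A i) = q 0 False (A 0)" for i
    using UNIV_index unfolding index_simps by (metis UNIV_I insertE singletonD)
  then have start: "q i b (start_ray i b) = q 0 False (A 0)" for i b
    using M by (simp add: start_ray_def)
  \<comment> \<open>Subtracting the common boundary constant does not change
    \<open>rot\<close>.\<close>
  define p where "p i b y = q i b y + (- q 0 False (A 0))" for i b y
  have p: "p i b \<in> bivariate_poly (r + 1)" for i b
    unfolding p_def[abs_def] by (intro bivariate_poly_add q(1) bivariate_poly_const)
  have cont: "fan_continuous p"
    using q(2) by (simp add: fan_continuous_def p_def)
  have "partial_deriv c (p i b) y = partial_deriv c (q i b) y" for c i b y
    unfolding p_def[abs_def]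
    by (simp only: partial_deriv_add[OF bivariate_poly_differentiable[OF q(1)] differentiable_const]
        partial_deriv_const add_0_right)
  then have "pw_eq z (rot (glue p)) v" "glue p \<in> S0 z (r + 1)"
    using glue_potential[OF vL p cont] q(3,4) by simp_all
  moreover have "glue p x = 0" if x: "x \<in> frontier (ps_triangle z)" for x
  proof -
    have "x \<in> ps_triangle z"
      using x closed_triangle by (simp add: frontier_def)
    then obtain i b where "x \<in> tri i b"
      by (rule triangle_cover)
    then show ?thesis
      using frontier_imp_\<mu>[OF x] const start by (simp add: glue_eq[OF cont] p_def)
  qed
  ultimately show ?thesis
    using continuous_on_L1[OF vL] v0 unfolding S0_ring_def by blast
qed

section \<open>The divergence theorem and the divergence equation with boundary values\<close>

definition skeleton :: "(real^2) set" where
  "skeleton = (\<Union>p\<in>UNIV. frontier (tri (fst p) (snd p)))"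

lemma negligible_skeleton: "negligible skeleton"
  unfolding skeleton_def
  by (intro negligible_Union) (auto intro: negligible_convex_frontier simp: tri_def)

lemma not_skeleton_interior:
  assumes "x \<in> ps_triangle z" "x \<notin> skeleton"
  obtains i b where "x \<in> interior (tri i b)"
proof -
  obtain i b where x: "x \<in> tri i b"
    using assms(1) by (rule triangle_cover)
  have "x \<notin> frontier (tri i b)"
    using assms(2) unfolding skeleton_def by force
  with x show thesis
    using that closure_subset unfolding frontier_def by blast
qed

text \<open>\<open>glue F\<close> is 0 outside the triangle and the pieces vanish on the outer
  edges. So the plane is covered by seven closed sets, the six triangles and the closure of the
  exterior, with a Lipschitz bound on each.\<close>

lemma glue_lipschitz:
  assumes cont: "fan_continuous F" and F: "\<And>i b. F i b \<in> bivariate_poly r"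
    and zero: "\<And>i b y. \<mu> i y = 0 \<Longrightarrow> F i b y = (0::real)"
  obtains C where "C-lipschitz_on UNIV (glue F)"
proof -
  have "\<exists>C. C-lipschitz_on (tri i b) (glue F)" for i b
  proof -
    have "convex (tri i b)"
      by (simp add: tri_def)
    then obtain C where "C-lipschitz_on (tri i b) (\<lambda>x. F i b (x - z 0))"
      using bivariate_poly_lipschitz[OF bivariate_poly_translate[OF F] compact_tri] by blast
    then have "C-lipschitz_on (tri i b) (glue F)"
      using glue_eq[OF cont] by (simp cong: lipschitz_on_cong)
    then show ?thesis by blast
  qed
  then obtain C where C: "\<And>i b. lipschitz_on (C i b) (tri i b) (glue F)"
    by metis
  define B where "B = (\<Sum>p\<in>UNIV. C (fst p) (snd p))"
  have nonneg: "0 \<le> C i b" for i b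
    using C lipschitz_on_nonneg by blast
  then have B0: "0 \<le> B"
    unfolding B_def by (intro sum_nonneg)
  have le: "C i b \<le> B" for i b
    unfolding B_def using nonneg
    by (intro order_trans[OF _ member_le_sum[of "(i, b)" UNIV "\<lambda>p. C (fst p) (snd p)"]]) auto
  define U where "U p = (case p of None \<Rightarrow> closure (- ps_triangle z) | Some q \<Rightarrow> tri (fst q) (snd q))"
    for p :: "(3 \<times> bool) option"
  have out: "glue F x = 0" if "x \<in> closure (- ps_triangle z)" for x
  proof (cases "x \<in> ps_triangle z")
    case True
    then have x: "x \<in> frontier (ps_triangle z)"
      using that closure_subset by (auto simp: frontier_closures)
    obtain i b where "x \<in> tri i b"
      using True by (rule triangle_cover)
    then show ?thesis
      using frontier_imp_\<mu>[OF x] by (simp add: glue_eq[OF cont] zero)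
  qed (simp add: glue_def)
  have "B-lipschitz_on UNIV (glue F)"
  proof (rule lipschitz_on_UNIV_closed_cover[of UNIV U])
    show "closed (U p)" for p
      by (cases p) (auto simp: U_def closed_tri)
    show "B-lipschitz_on (U p) (glue F)" for p
    proof (cases p)
      case None
      then show ?thesis
        using B0 by (auto intro!: lipschitz_onI simp: U_def out)
    next
      case (Some q)
      then show ?thesis
        using lipschitz_on_le[OF C le] by (simp add: U_def)
    qed
    show "(\<Union>p\<in>UNIV. U p) = UNIV"
    proof -
      have "x \<in> (\<Union>p\<in>UNIV. U p)" for x
      proof (cases "x \<in> ps_triangle z")
        case True
        then obtain i b where "x \<in> tri i b"
          by (rule triangle_cover)
        then show ?thesis
          by (intro UN_I[of "Some (i, b)"]) (simp_all add: U_def)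
      next
        case False
        then show ?thesis
          using closure_subset[of "- ps_triangle z"] by (intro UN_I[of None]) (auto simp: U_def)
      qed
      then show ?thesis by blast
    qed
  qed (use B0 in auto)
  then show thesis
    by (rule that)
qed

text \<open>Off the null set \<open>skeleton\<close> the extension by 0 is differentiable, as a
  polynomial inside a triangle and as 0 outside, so the result on Lipschitz functions with bounded
  support applies.\<close>

lemma integral_partial_deriv_glue:
  assumes cont: "fan_continuous F" and F: "\<And>i b. F i b \<in> bivariate_poly r"
    and zero: "\<And>i b y. \<mu> i y = 0 \<Longrightarrow> F i b y = (0::real)"
  shows "(partial_deriv c (glue F) has_integral 0) (ps_triangle z)"
proof -
  obtain C where C: "C-lipschitz_on UNIV (glue F)"
    using glue_lipschitz[OF assms] .
  obtain a where a: "ps_triangle z \<subseteq> cbox (- a) a"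
    using bounded_subset_cbox_symmetric[OF compact_imp_bounded[OF compact_triangle]] by blast
  define g where "g x = (if x \<in> ps_triangle z then partial_deriv c (glue F) x else 0)" for x
  have "(g has_integral 0) UNIV"
  proof (rule has_integral_directional_derivative_zero[OF C _ negligible_skeleton, of "- a" a "axis c 1"])
    show "glue F x = 0" if "x \<notin> cbox (- a) a" for x
      using that a by (auto simp: glue_def)
    fix x assume x: "x \<notin> skeleton"
    show "((\<lambda>t. glue F (x + t *\<^sub>R axis c 1)) has_real_derivative g x) (at 0)"
    proof (cases "x \<in> ps_triangle z")
      case True
      then obtain i b where i: "x \<in> interior (tri i b)"
        using x by (rule not_skeleton_interior)
      have "(\<lambda>x. F i b (x - z 0)) differentiable at x"
        by (rule bivariate_poly_differentiable[OF bivariate_poly_translate[OF F]])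
      then obtain D where "((\<lambda>x. F i b (x - z 0)) has_derivative D) (at x)"
        unfolding differentiable_def by blast
      then have "(glue F has_derivative D) (at x)"
        by (rule has_derivative_transform_within_open[OF _ open_interior i])
          (simp add: glue_eq[OF cont interior_tri_mem])
      then have "glue F differentiable at x"
        unfolding differentiable_def by blast
      from directional_derivative_axis[OF this] show ?thesis
        using True by (simp add: g_def)
    next
      case False
      have "((\<lambda>_. 0) has_derivative (\<lambda>_. 0)) (at x)"
        by simp
      then have D: "(glue F has_derivative (\<lambda>_. 0)) (at x)"
        by (rule has_derivative_transform_within_open[of _ _ _ _ "- ps_triangle z"])
          (use False closed_triangle in \<open>auto simp: glue_def\<close>)
      then have "glue F differentiable at x"
        unfolding differentiable_def by blast
      from directional_derivative_axis[OF this] show ?thesis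
        using False partial_deriv_eq[OF D] by (simp add: g_def)
    qed
  qed simp
  then show ?thesis
    unfolding g_def has_integral_restrict_UNIV .
qed

lemma integral_divergence_glue:
  assumes "fan_continuous V" "\<And>i b c. (\<lambda>y. V i b y $ c) \<in> bivariate_poly r"
    "\<And>i b y. \<mu> i y = 0 \<Longrightarrow> V i b y = 0"
  shows "(divergence (glue V) has_integral 0) (ps_triangle z)"
proof -
  have "(partial_deriv c (\<lambda>y. glue V y $ c) has_integral 0) (ps_triangle z)" for c
    unfolding glue_nth using assms
    by (intro integral_partial_deriv_glue) (auto simp: fan_continuous_def)
  from has_integral_add[OF this[of 1] this[of 2]] show ?thesis
    by (simp add: divergence_def[abs_def])
qed

lemma integrable_on_triangle:
  fixes p :: "real^2 \<Rightarrow> real"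
  assumes "continuous_on (ps_triangle z) p"
  shows "p integrable_on ps_triangle z"
proof -
  have "(\<lambda>x. indicator (ps_triangle z) x *\<^sub>R p x) integrable_on UNIV"
    by (intro integrable_on_lborel borel_integrable_compact compact_triangle assms)
  also have "(\<lambda>x. indicator (ps_triangle z) x *\<^sub>R p x) = (\<lambda>x. if x \<in> ps_triangle z then p x else 0)"
    by (auto simp: indicator_def)
  finally show ?thesis
    by (simp add: integrable_restrict_UNIV)
qed

text \<open>Divided by \<open>\<delta>\<close>, the integrand is nonnegative up to a null set and
  positive inside a triangle of sector 0, so its integral could not be 0.\<close>

lemma residual_zero:
  assumes int: "(\<phi> has_integral 0) (ps_triangle z)"
    and \<phi>: "\<And>i b x. x \<in> interior (tri i b) \<Longrightarrow> \<phi> x = (if i = 0 then \<delta> * \<mu> i (x - z 0) ^ r else 0)"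
  shows "\<delta> = 0"
proof (rule ccontr)
  assume \<delta>: "\<delta> \<noteq> 0"
  \<comment> \<open>Nothing is known about \<open>\<phi>\<close> on the skeleton; the reset to 0
    gives the right sign on the whole triangle.\<close>
  define \<psi> where "\<psi> x = (if x \<in> skeleton then 0 else \<phi> x / \<delta>)" for x
  have \<psi>: "(\<psi> has_integral 0) (ps_triangle z)"
    by (rule has_integral_spike[OF negligible_skeleton])
      (use has_integral_divide[OF int, of \<delta>] in \<open>auto simp: \<psi>_def\<close>)
  have \<psi>_eq: "\<psi> x = (if i = 0 then \<mu> i (x - z 0) ^ r else 0)"
    if "x \<in> interior (tri i b)" "x \<notin> skeleton" for x i b
    using \<phi>[OF that(1)] that(2) \<delta> by (simp add: \<psi>_def)
  have nonneg: "\<psi> x \<ge> 0" if x: "x \<in> ps_triangle z" for x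
  proof (cases "x \<in> skeleton")
    case False
    obtain i b where i: "x \<in> interior (tri i b)"
      using x False by (rule not_skeleton_interior)
    have "\<mu> i (x - z 0) \<ge> 0"
      using interior_tri_mem[OF i] by (intro \<mu>_nonneg) (simp add: tri_iff)
    then show ?thesis
      using \<psi>_eq[OF i False] by (cases "i = 0") auto
  qed (simp add: \<psi>_def)
  obtain x where "x \<in> interior (tri 0 False)"
    using interior_tri_nonempty by blast
  \<comment> \<open>On a box, a continuous nonnegative function with integral 0 vanishes, which
    contradicts positivity at \<open>x\<close>.\<close>
  then obtain c d where box: "x \<in> box c d" "cbox c d \<subseteq> interior (tri 0 False)"
    using open_contains_cbox[of "interior (tri 0 False)" x] by (metis open_interior)
  define m where "m y = (1 + n 0 \<bullet> (y - z 0)) ^ r" for y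
  have m: "continuous_on (cbox c d) m"
    unfolding m_def by (intro continuous_intros)
  have m_\<psi>: "m y = \<psi> y" if "y \<in> cbox c d - skeleton" for y
    using \<psi>_eq[of y 0 False] that box(2) by (auto simp: m_def \<mu>_def)
  have m_int: "m integrable_on cbox c d"
    using m by (rule integrable_continuous)
  have \<psi>_int: "\<psi> integrable_on cbox c d" "integral (cbox c d) \<psi> = integral (cbox c d) m"
    using integrable_spike[OF m_int negligible_skeleton] integral_spike[OF negligible_skeleton, of "cbox c d" \<psi> m] m_\<psi>
    by auto
  have sub: "cbox c d \<subseteq> ps_triangle z"
    using box(2) interior_subset tri_subset by blast
  have "integral (cbox c d) \<psi> \<le> integral (ps_triangle z) \<psi>"
    using sub \<psi>_int(1) \<psi> nonneg by (intro integral_subset_le) (auto simp: integrable_on_def)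
  also have "\<dots> = 0"
    using \<psi> by (rule integral_unique)
  finally have le: "integral (cbox c d) m \<le> 0"
    using \<psi>_int by simp
  have m_nonneg: "0 < m y" if "y \<in> cbox c d" for y
  proof -
    have y: "y \<in> interior (tri 0 False)"
      using that box by blast
    then have "\<mu> 0 (y - z 0) \<ge> 0"
      using interior_tri_mem by (intro \<mu>_nonneg) (auto simp flip: tri_iff)
    moreover have "\<mu> 0 (y - z 0) \<noteq> 0"
      using \<mu>_imp_frontier[OF interior_tri_mem[OF y]] interior_mono[OF tri_subset] y
      by (auto simp: frontier_def)
    ultimately show ?thesis
      by (simp add: m_def \<mu>_def)
  qed
  have "integral (cbox c d) m = 0"
    using le integral_nonneg[OF m_int] m_nonneg by (meson antisym less_imp_le)
  then have "(m has_integral 0) (cbox c d)"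
    using m_int by (metis integrable_integral)
  then have "m x = 0"
    using m m_nonneg box(1) box_subset_cbox[of c d]
    by (intro has_integral_0_cbox_imp_0[of c d m x]) (auto intro: less_imp_le)
  then show False
    using m_nonneg[of x] box(1) box_subset_cbox[of c d] by auto
qed

lemma ex_divergence_preimage_ring:
  assumes p: "p \<in> L2_ring z r"
  shows "\<exists>v\<in>S1_ring z (r + 1). pw_eq z (divergence v) p"
proof -
  have pL: "p \<in> L0 z r" and p0: "\<And>x. x \<in> frontier (ps_triangle z) \<Longrightarrow> p x = 0"
    and pI: "integral (ps_triangle z) p = 0" and pc: "continuous_on (ps_triangle z) p"
    using p by (auto simp: L2_ring_def L2_def L0_def)
  obtain h where h: "\<And>k i b. hpoly k (h k i b)" "\<And>k. fan_continuous (h k)"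
    "\<And>i b x. x \<in> tri i b \<Longrightarrow> p x = (\<Sum>k\<le>r. h k i b (x - z 0))"
    by (rule L0_decompose[OF pL]) (rule that)
  have "solvable r (\<lambda>i b y. \<Sum>k\<le>r. h k i b y)"
  proof (rule solvable_sum)
    fix k assume "k \<in> {..r}"
    moreover have "h k i False (M i) = h k i True (M i)" for i
      using h(2)[of k] unfolding fan_continuous_def
      by (metis atLeastAtMost_iff order_refl scaleR_one zero_le_one)
    \<comment> \<open>Raising the part of degree \<open>k\<close> by \<open>r - k\<close> brings all
      parts to the common total degree \<open>r\<close> of the defect.\<close>
    ultimately show "solvable r (h k)"
      using solvable_raise[of k "h k" "r - k" 0, OF h(1)] by simp
  qed auto
  then obtain V \<delta> where V: "\<And>i b c. (\<lambda>y. V i b y $ c) \<in> bivariate_poly (Suc r)" "fan_continuous V"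
    "\<And>i b y. \<mu> i y = 0 \<Longrightarrow> V i b y = 0"
    "\<And>i b y. divergence (V i b) y = (\<Sum>k\<le>r. h k i b y) - (if i = 0 then \<delta> * \<mu> i y ^ r else 0)"
    by (rule solvableE) (rule that)
  have div: "divergence (glue V) x = p x - (if i = 0 then \<delta> * \<mu> i (x - z 0) ^ r else 0)"
    if "x \<in> interior (tri i b)" for x i b
    by (simp add: divergence_glue[OF V(2,1) that] V(4) h(3)[OF interior_tri_mem[OF that]])
  have "(p has_integral 0) (ps_triangle z)"
    using integrable_on_triangle[OF pc] pI by (metis integrable_integral)
  \<comment> \<open>Both integrals are 0, that of \<open>p\<close> by assumption and that of the
    divergence by the boundary values of \<open>V\<close>; the difference of the integrands is the
    defect.\<close>
  from has_integral_diff[OF this integral_divergence_glue[OF V(2,1,3)]]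
  have "((\<lambda>x. p x - divergence (glue V) x) has_integral 0) (ps_triangle z)"
    by simp
  then have "\<delta> = 0"
    by (rule residual_zero[where r = r]) (simp add: div)
  then have eq: "pw_eq z (divergence (glue V)) p"
    by (intro pw_eqI) (simp add: div)
  have L1: "glue V \<in> L1 z (r + 1)"
    using glue_L1[OF V(2,1)] by simp
  have "glue V x = 0" if x: "x \<in> frontier (ps_triangle z)" for x
  proof -
    have "x \<in> ps_triangle z"
      using x closed_triangle by (simp add: frontier_def)
    then obtain i b where "x \<in> tri i b"
      by (rule triangle_cover)
    then show ?thesis
      using frontier_imp_\<mu>[OF x] by (simp add: glue_eq[OF V(2)] V(3))
  qed
  then show ?thesis
    using S1I[OF L1 pL eq] eq pc p0 unfolding S1_ring_def by blast
qed

end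

section \<open>Coordinates adapted to a given Powell-Sabin split\<close>

lemma ps_triangulation_of_powell_sabin:
  assumes "powell_sabin z"
  shows "\<exists>A M n \<theta>. ps_triangulation A M n \<theta> z"
proof -
  have zs: "det (vector [z 2 - z 1, z 3 - z 1] :: real^2^2) > 0"
    "z 0 \<in> interior (convex hull {z 1, z 2, z 3})"
    "z 4 \<in> open_segment (z 2) (z 3)" "z 5 \<in> open_segment (z 3) (z 1)" "z 6 \<in> open_segment (z 1) (z 2)"
    using assms by (auto simp: powell_sabin_def)
  define A where "A i = (if i = 0 then z 3 else if i = 1 then z 1 else z 2) - z 0" for i :: 3
  define M where "M i = (if i = 0 then z 5 else if i = 1 then z 6 else z 4) - z 0" for i :: 3
  have A: "A 0 = z 3 - z 0" "A 1 = z 1 - z 0" "A 2 = z 2 - z 0"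
    by (simp_all add: A_def)
  have M: "M 0 = z 5 - z 0" "M 1 = z 6 - z 0" "M 2 = z 4 - z 0"
    by (simp_all add: M_def)
  define u where "u = z 2 - z 1"
  define v where "v = z 3 - z 1"
  have D: "cross2 u v > 0"
    using zs(1) by (simp add: u_def v_def det_2 cross2_def mult.commute)
  have "\<not> collinear {z 1, z 2, z 3}"
  proof
    assume "collinear {z 1, z 2, z 3}"
    then have "collinear {0, u, v}"
      using collinear_3[of "z 2" "z 1" "z 3"] by (simp add: u_def v_def insert_commute)
    then show False
      using D unfolding collinear_lemma by (auto simp: cross2_simps)
  qed
  then have "interior (convex hull {z 1, z 2, z 3}) = {v. \<exists>x y w. 0 < x \<and> 0 < y \<and> 0 < w \<and> x + y + w = 1 \<and>
      x *\<^sub>R z 1 + y *\<^sub>R z 2 + w *\<^sub>R z 3 = v}"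
    by (rule interior_convex_hull_3_minimal) simp
  then obtain a b c where abc: "0 < a" "0 < b" "0 < c" "a + b + c = 1"
    "z 0 = a *\<^sub>R z 1 + b *\<^sub>R z 2 + c *\<^sub>R z 3"
    using zs(2) by auto
  have A1: "A 1 = - b *\<^sub>R u - c *\<^sub>R v"
  proof -
    have "z 1 = (a + b + c) *\<^sub>R z 1"
      by (simp add: abc(4))
    then show ?thesis
      unfolding A(2) abc(5) u_def v_def by (simp add: algebra_simps)
  qed
  have "A 2 = A 1 + u" "A 0 = A 1 + v"
    by (simp_all add: A u_def v_def)
  then have A20: "A 2 = (1 - b) *\<^sub>R u - c *\<^sub>R v" "A 0 = - b *\<^sub>R u + (1 - c) *\<^sub>R v"
    unfolding A1 by (simp_all add: algebra_simps)
  \<comment> \<open>The factors are the barycentric coordinates of \<open>z 0\<close>, with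
    \<open>1 - b - c = a\<close>; their positivity and that of \<open>cross2 u v\<close> give the
    orientation of the fan.\<close>
  have cross_A: "cross2 (A 1) (A 2) = c * cross2 u v" "cross2 (A 2) (A 0) = (1 - b - c) * cross2 u v"
    "cross2 (A 0) (A 1) = b * cross2 u v"
    unfolding A1 A20 by (simp_all add: cross2_simps cross2_commute[of v u] algebra_simps)
  have cr: "cross2 (A i) (A (i + 1)) > 0" for i
  proof -
    have "cross2 (A 1) (A 2) > 0" "cross2 (A 2) (A 0) > 0" "cross2 (A 0) (A 1) > 0"
      using abc D by (simp_all add: cross_A)
    moreover have "i \<in> {0, 1, 2}"
      using UNIV_index by blast
    ultimately show ?thesis
      by (elim insertE emptyE) (simp_all only: index_simps)
  qed
  have "\<exists>\<theta>. 0 < \<theta> \<and> \<theta> < 1 \<and> M i = (1 - \<theta>) *\<^sub>R A i + \<theta> *\<^sub>R A (i + 1)" for i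
  proof -
    have seg: "\<exists>\<theta>. 0 < \<theta> \<and> \<theta> < 1 \<and> m - o' = (1 - \<theta>) *\<^sub>R (p - o') + \<theta> *\<^sub>R (q - o')"
      if "m \<in> open_segment p q" for m p q o' :: "real^2"
      using that unfolding in_segment by (auto simp: algebra_simps)
    have "i \<in> {0, 1, 2}"
      using UNIV_index by blast
    then show ?thesis
      using seg[OF zs(3), of "z 0"] seg[OF zs(4), of "z 0"] seg[OF zs(5), of "z 0"]
      by (elim insertE emptyE) (simp_all only: index_simps A M)
  qed
  then obtain \<theta> where \<theta>: "\<And>i. 0 < \<theta> i" "\<And>i. \<theta> i < 1" "\<And>i. M i = (1 - \<theta> i) *\<^sub>R A i + \<theta> i *\<^sub>R A (i + 1)"
    by metis
  have "\<exists>n. n \<bullet> A i = -1 \<and> n \<bullet> A (i + 1) = -1" for i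
  proof -
    have "cross2 (A i) (A (i + 1)) \<noteq> 0"
      using cr[of i] by simp
    then show ?thesis
      using cross2_solve by (metis inner_commute)
  qed
  then obtain n where n: "\<And>i. n i \<bullet> A i = -1" "\<And>i. n i \<bullet> A (i + 1) = -1"
    by metis
  have "ps_triangulation A M n \<theta> z"
    by unfold_locales (use cr \<theta> n A M zs(2) in \<open>simp_all add: ps_triangle_def\<close>)
  then show ?thesis
    by blast
qed

theorem corollary3p9:
  fixes z :: "nat \<Rightarrow> real^2" and r :: nat
  assumes "powell_sabin z"
  shows "(\<forall>p\<in>L2_ring z r. \<exists>v\<in>S1_ring z (r + 1). pw_eq z (divergence v) p) \<and>
         (\<forall>p\<in>L2 z r. \<exists>v\<in>S1 z (r + 1). pw_eq z (divergence v) p) \<and>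
         (\<forall>v\<in>L1_ring z r. pw_eq z (divergence v) (\<lambda>_. 0) \<longrightarrow>
            (\<exists>q\<in>S0_ring z (r + 1). pw_eq z (rot q) v)) \<and>
         (\<forall>v\<in>L1 z r. pw_eq z (divergence v) (\<lambda>_. 0) \<longrightarrow>
            (\<exists>q\<in>S0 z (r + 1). pw_eq z (rot q) v))"
proof -
  obtain A M n \<theta> where "ps_triangulation A M n \<theta> z"
    using ps_triangulation_of_powell_sabin[OF assms] by blast
  then interpret ps_triangulation A M n \<theta> z .
  show ?thesis
    using ex_divergence_preimage_ring ex_divergence_preimage ex_rot_preimage_ring ex_rot_preimage
    by blast
qed

end
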